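(* The problem $\mathsf{QBSF}$ is in $\mathrm{AEXP}(\mathrm{poly})$.
   Context: Quantified Boolean second-order formulas (qbsfs): the constants $0,1$ are qbsfs; if $f^n$ is a function variable of arity $n \ge 0$ and $\varphi_1,\ldots,\varphi_n$ are qbsfs, then $f^n(\varphi_1,\ldots,\varphi_n)$, $\varphi_1 \land \varphi_2$, $\neg\varphi_1$ and $\exists f^n \varphi_1$ are qbsfs ($\lor,\to,\leftrightarrow,\forall$ are the usual abbreviations). An interpretation $\mathcal I$ maps function variables $f^n$ to Boolean functions $\{0,1\}^n\to\{0,1\}$; the value of a formula is defined as usual, with $f^n(\varphi_1,\ldots,\varphi_n)$ evaluating to $\mathcal I(f^n)$ applied to the values of the $\varphi_i$, and $\exists f^n\varphi$ true iff $\varphi$ is true for some choice of Boolean function $F\colon\{0,1\}^n\to\{0,1\}$ for $f^n$. $\mathsf{QBSF}$ is the set of all qbsfs satisfied by the empty interpretation (i.e. closed true qbsfs). For $g(n)\ge1$, $\mathrm{ATIME}^{\Sigma}(t,g)$ is the class of problems decided by an alternating Turing machine starting in an existential state in time $O(t(n))$ with at most $g(n)$ alternations (counting the initial configuration as the first); $\mathrm{AEXP}(\mathrm{poly}) = \bigcup_{t \in 2^{n^{O(1)}},\, p \in n^{O(1)}} \mathrm{ATIME}^{\Sigma}(t,p)$. *)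

theory Defs
  imports Main
begin

text \<open>A function variable f^n is identified by a name i and its arity n;
  App i n args is f^n applied to args (well-formed iff length args = n).\<close>

datatype qbsf =
    FF
  | TT
  | App nat nat "qbsf list"
  | Conj qbsf qbsf
  | Neg qbsf
  | Ex nat nat qbsf

fun wf_qbsf :: "qbsf \<Rightarrow> bool" where
  "wf_qbsf FF = True"
| "wf_qbsf TT = True"
| "wf_qbsf (App i n args) = (length args = n \<and> (\<forall>a\<in>set args. wf_qbsf a))"
| "wf_qbsf (Conj a b) = (wf_qbsf a \<and> wf_qbsf b)"
| "wf_qbsf (Neg a) = wf_qbsf a"
| "wf_qbsf (Ex i n a) = wf_qbsf a"

fun fv :: "qbsf \<Rightarrow> (nat \<times> nat) set" where
  "fv FF = {}"
| "fv TT = {}"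
| "fv (App i n args) = insert (i, n) (\<Union>a\<in>set args. fv a)"
| "fv (Conj a b) = fv a \<union> fv b"
| "fv (Neg a) = fv a"
| "fv (Ex i n a) = fv a - {(i, n)}"

text \<open>An interpretation maps (name, arity) to a Boolean function; only its
  values on argument lists of length = arity matter.\<close>

type_synonym interp = "nat \<Rightarrow> nat \<Rightarrow> bool list \<Rightarrow> bool"

fun eval :: "interp \<Rightarrow> qbsf \<Rightarrow> bool" where
  "eval I FF = False"
| "eval I TT = True"
| "eval I (App i n args) = I i n (map (eval I) args)"
| "eval I (Conj a b) = (eval I a \<and> eval I b)"
| "eval I (Neg a) = (\<not> eval I a)"
| "eval I (Ex i n a) = (\<exists>F :: bool list \<Rightarrow> bool. eval (I(i := (I i)(n := F))) a)"

definition empty_interp :: interp where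
  "empty_interp = (\<lambda>_ _ _. False)"

definition QBSF_formulas :: "qbsf set" where
  "QBSF_formulas = {\<phi>. wf_qbsf \<phi> \<and> fv \<phi> = {} \<and> eval empty_interp \<phi>}"

datatype sym = SZero | SOne | SApp | SAnd | SNeg | SEx | SB0 | SB1 | SHash

fun bin :: "nat \<Rightarrow> sym list" where
  "bin k = (if k = 0 then [] else (if even k then SB0 else SB1) # bin (k div 2))"

declare bin.simps[simp del]

fun enc :: "qbsf \<Rightarrow> sym list" where
  "enc FF = [SZero]"
| "enc TT = [SOne]"
| "enc (App i n args) = [SApp] @ bin i @ [SHash] @ bin n @ [SHash] @ concat (map enc args)"
| "enc (Conj a b) = [SAnd] @ enc a @ enc b"
| "enc (Neg a) = [SNeg] @ enc a"
| "enc (Ex i n a) = [SEx] @ bin i @ [SHash] @ bin n @ [SHash] @ enc a"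

definition QBSF :: "sym list set" where
  "QBSF = enc ` QBSF_formulas"

datatype skind = Exist | Univ | Accept | Reject

text \<open>States are 0..<nst (start state 0); tape symbols 0..<nsym, 0 = blank;
  transitions (q, a, q', b, m): in state q reading a, go to q', write b,
  move head by m \<in> {-1,0,1}.\<close>
record atm =
  nst :: nat
  nsym :: nat
  kind :: "nat \<Rightarrow> skind"
  delta :: "(nat \<times> nat \<times> nat \<times> nat \<times> int) set"

fun sym_code :: "sym \<Rightarrow> nat" where
  "sym_code SZero = 1" | "sym_code SOne = 2" | "sym_code SApp = 3" | "sym_code SAnd = 4"
| "sym_code SNeg = 5" | "sym_code SEx = 6" | "sym_code SB0 = 7" | "sym_code SB1 = 8"
| "sym_code SHash = 9"

definition wf_atm :: "atm \<Rightarrow> bool" where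
  "wf_atm M \<longleftrightarrow> 0 < nst M \<and> 10 \<le> nsym M \<and>
     (\<forall>(q, a, q', b, m) \<in> delta M. q < nst M \<and> a < nsym M \<and> q' < nst M \<and> b < nsym M
        \<and> m \<in> {-1, 0, 1})"

type_synonym config = "nat \<times> (int \<Rightarrow> nat) \<times> int"

definition init_config :: "sym list \<Rightarrow> config" where
  "init_config w = (0, (\<lambda>i. if 0 \<le> i \<and> i < int (length w) then sym_code (w ! nat i) else 0), 0)"

definition succs :: "atm \<Rightarrow> config \<Rightarrow> config set" where
  "succs M c = (case c of (q, tp, h) \<Rightarrow>
     {(q', tp(h := b), h + m) | q' b m. (q, tp h, q', b, m) \<in> delta M})"

definition halting :: "atm \<Rightarrow> config \<Rightarrow> bool" where
  "halting M c \<longleftrightarrow> kind M (fst c) \<in> {Accept, Reject}"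

fun halts_within :: "atm \<Rightarrow> nat \<Rightarrow> config \<Rightarrow> bool" where
  "halts_within M 0 c = halting M c"
| "halts_within M (Suc k) c = (halting M c \<or> (\<forall>c' \<in> succs M c. halts_within M k c'))"

fun acc :: "atm \<Rightarrow> nat \<Rightarrow> config \<Rightarrow> bool" where
  "acc M 0 c = (kind M (fst c) = Accept)"
| "acc M (Suc k) c = (case kind M (fst c) of
      Accept \<Rightarrow> True
    | Reject \<Rightarrow> False
    | Exist \<Rightarrow> (\<exists>c' \<in> succs M c. acc M k c')
    | Univ \<Rightarrow> (\<forall>c' \<in> succs M c. acc M k c'))"

text \<open>alt_ok M k c g: along every path of length \<le> k starting in c, the number of
  maximal blocks of existential/universal states (the current block counted) is at most g.\<close>
fun alt_ok :: "atm \<Rightarrow> nat \<Rightarrow> config \<Rightarrow> nat \<Rightarrow> bool" where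
  "alt_ok M 0 c g = True"
| "alt_ok M (Suc k) c g = (halting M c \<or>
      (\<forall>c' \<in> succs M c.
         if halting M c' \<or> kind M (fst c') = kind M (fst c) then alt_ok M k c' g
         else 2 \<le> g \<and> alt_ok M k c' (g - 1)))"

text \<open>ATIME^Sigma(t, g): languages decided by an ATM starting in an existential
  state, in time O(t(n)), with at most g(n) alternations (initial configuration
  counted as the first).\<close>
definition ATIME_Sigma :: "(nat \<Rightarrow> nat) \<Rightarrow> (nat \<Rightarrow> nat) \<Rightarrow> sym list set set" where
  "ATIME_Sigma t g = {L. \<exists>M c. wf_atm M \<and> kind M 0 = Exist \<and>
      (\<forall>w. let T = c * t (length w) + c in
             halts_within M T (init_config w) \<and>
             alt_ok M T (init_config w) (g (length w)) \<and>
             (w \<in> L \<longleftrightarrow> acc M T (init_config w)))}"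

definition poly_bounded :: "(nat \<Rightarrow> nat) \<Rightarrow> bool" where
  "poly_bounded p \<longleftrightarrow> (\<exists>k. \<forall>n. p n \<le> (n + 1) ^ k)"

definition AEXP_poly :: "sym list set set" where
  "AEXP_poly = (\<Union>{ATIME_Sigma t p | t p. (\<exists>q. poly_bounded q \<and> t = (\<lambda>n. 2 ^ q n))
                                       \<and> poly_bounded p \<and> (\<forall>n. 1 \<le> p n)})"

end

theory Submission
  imports Defs
begin

text \<open>
  The alternating machine plays an evaluation game along a single branch of the formula.  A position
  is the claim that a string encodes a well-formed formula with value \<open>v\<close> under the current
  environment.  At a quantifier, the player interested in the result (the existential one if \<open>v\<close> is
  true, the universal one otherwise) writes down a function table; arities that matter are at most
  the input length, so exponentially long tables suffice.  At any other node the existential player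
  splits the rest of the string into arguments and claims a value for each of them; the universal
  player then either challenges one argument or has the head checked against the claimed values.
  Every round shortens the string, so there are linearly many alternations.

  The game is implemented by a machine with several stacks, which a single-tape machine simulates
  by keeping each stack in a track of its tape, with the tops in a fixed cell.
\<close>

section \<open>Alternating computations\<close>

text \<open>Quantifiers may sit below negations and inside arguments of function variables, and no
  prenex form is used. One challenge per round suffices: if a claim is wrong, then either one of the
  claims about the arguments is wrong or the head does not fit them. Both claims, value true and
  value false, include that the string is a formula and that its variables are bound. A malformed
  string refutes both, so syntax is checked by the game itself. Arities are written in binary, so a
  quantifier may announce an arity exponential in the input length, and a table for it would be
  doubly exponential. But a variable of arity \<open>n\<close> that occurs in the body comes with
  \<open>n\<close> arguments of nonempty code and with the digits of \<open>n\<close>, which gives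
  \<open>2 ^ n * (n + 1)\<close> \<le> \<open>2 ^ length w\<close>; for a variable that does not
  occur any table will do. A lookup in the environment costs two switches per section, because
  comparing consumes the stacks, but it happens only once, at the end of a play. Simulating stacks
  on one tape roughly squares the time and adds no switches, since all steps that simulate one move
  have the kind of that move.\<close>

definition alt_cost :: "skind \<Rightarrow> skind \<Rightarrow> nat" where
  "alt_cost \<kappa> \<kappa>' = (if \<kappa>' \<in> {\<kappa>, Accept, Reject} then 0 else 1)"

definition quant :: "skind \<Rightarrow> 'c set \<Rightarrow> ('c \<Rightarrow> bool) \<Rightarrow> bool" where
  "quant \<kappa> A f = (if \<kappa> = Univ then \<forall>c\<in>A. f c else \<exists>c\<in>A. f c)"

text \<open>\<open>decides K N t h c b\<close>: the alternating computation from \<open>c\<close> halts within \<open>t\<close> steps, switches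
  between existential and universal configurations at most \<open>h\<close> times on every path, and accepts
  iff \<open>b\<close>.\<close>

inductive decides :: "('c \<Rightarrow> skind) \<Rightarrow> ('c \<Rightarrow> 'c set) \<Rightarrow> nat \<Rightarrow> nat \<Rightarrow> 'c \<Rightarrow> bool \<Rightarrow> bool"
  for K N where
  accept: "K c = Accept \<Longrightarrow> decides K N t h c True"
| reject: "K c = Reject \<Longrightarrow> decides K N t h c False"
| branch: "K c \<in> {Exist, Univ} \<Longrightarrow>
    \<forall>c'\<in>N c. decides K N t (g c') c' (f c') \<and> g c' + alt_cost (K c) (K c') \<le> h \<Longrightarrow>
    decides K N (Suc t) h c (quant (K c) (N c) f)"

text \<open>Allows an outcome to be picked by \<open>SOME\<close> and identified afterwards,
  whatever budgets it was obtained with.\<close>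

lemma decides_unique:
  "decides K N t h c b \<Longrightarrow> decides K N t' h' c b' \<Longrightarrow> b = b'"
proof (induction arbitrary: t' h' b' rule: decides.induct)
  case (branch c t g f h)
  note IH = branch.IH
  from branch.prems show ?case
  proof (cases rule: decides.cases)
    case (branch t'' g' f')
    have "f c' = f' c'" if "c' \<in> N c" for c'
      using IH branch(4) that by blast
    then show ?thesis using branch by (simp add: quant_def)
  qed (use branch.hyps in auto)
qed (auto elim: decides.cases)

lemma decides_mono:
  "decides K N t h c b \<Longrightarrow> t \<le> t' \<Longrightarrow> h \<le> h' \<Longrightarrow> decides K N t' h' c b"
proof (induction arbitrary: t' h' rule: decides.induct)
  case (branch c t g f h)
  then obtain t'' where t': "t' = Suc t''" "t \<le> t''" by (cases t') auto
  show ?case unfolding t'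
    by (rule decides.branch[where g = g]) (use branch t' in \<open>auto intro: order_trans\<close>)
qed (auto intro: decides.intros)

text \<open>The map \<open>e\<close> need not be injective: if two choices lead to the same
  configuration, \<open>decides_unique\<close> makes \<open>F\<close> agree on them, so
  \<open>F\<close> induces a function on successors. Every choice may bring its own switch
  budget.\<close>

lemma decides_image:
  assumes K: "K c = \<kappa>" "\<kappa> \<in> {Exist, Univ}" and N: "N c = e ` A"
    and A: "\<And>x. x \<in> A \<Longrightarrow> \<exists>g. decides K N t g (e x) (F x) \<and> g + alt_cost \<kappa> (K (e x)) \<le> h"
  shows "decides K N (Suc t) h c (quant \<kappa> A F)"
proof -
  define f where "f = (\<lambda>c'. SOME b. \<exists>g. decides K N t g c' b)"
  define g where "g = (\<lambda>c'. SOME g. decides K N t g c' (f c') \<and> g + alt_cost \<kappa> (K c') \<le> h)"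
  have f: "f (e x) = F x" if "x \<in> A" for x
  proof -
    have "\<exists>b g. decides K N t g (e x) b" using A[OF that] by blast
    then have "\<exists>g. decides K N t g (e x) (f (e x))" unfolding f_def by (rule someI_ex)
    with A[OF that] show ?thesis by (blast dest: decides_unique)
  qed
  have g: "decides K N t (g (e x)) (e x) (f (e x)) \<and> g (e x) + alt_cost \<kappa> (K (e x)) \<le> h"
    if "x \<in> A" for x
    unfolding g_def by (rule someI_ex) (use A[OF that] f[OF that] in simp)
  have "decides K N (Suc t) h c (quant (K c) (N c) f)"
    by (rule decides.branch[where g = g]) (use K N g in auto)
  moreover have "quant (K c) (N c) f = quant \<kappa> A F"
    using K N f by (simp add: quant_def)
  ultimately show ?thesis by simp
qed

lemma decides_step:
  assumes "K c = \<kappa>" "\<kappa> \<in> {Exist, Univ}" "N c = {c'}"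
    and "decides K N t g c' b" "g + alt_cost \<kappa> (K c') \<le> h"
  shows "decides K N (Suc t) h c b"
  using decides_image[where K = K and c = c and N = N and e = "\<lambda>_. c'" and A = "{()}"
      and F = "\<lambda>_. b" and t = t and h = h] assms by (cases "\<kappa> = Univ") (simp_all add: quant_def, blast+)

lemma decides_map:
  assumes K: "\<And>c. K' (e c) = K c" and N: "\<And>c. N' (e c) = e ` N c"
  shows "decides K N t h c b \<Longrightarrow> decides K' N' t h (e c) b"
proof (induction rule: decides.induct)
  case (branch c t g f h)
  show ?case
    by (rule decides_image[where e = e]) (use branch K N in auto)
qed (auto intro: decides.intros simp: K)

lemma alt_ok_mono: "alt_ok M k c g \<Longrightarrow> g \<le> g' \<Longrightarrow> alt_ok M k c g'"
proof (induction k arbitrary: c g g')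
  case (Suc k)
  have "alt_ok M k c' (g - 1) \<Longrightarrow> alt_ok M k c' (g' - 1)" for c'
    using Suc.IH[of c' "g - 1" "g' - 1"] Suc.prems(2) by simp
  then show ?case using Suc by (auto split: if_splits)
qed simp

text \<open>\<open>alt_ok\<close> counts maximal blocks including the current one,
  \<open>decides\<close> counts the switches between them; hence \<open>Suc h\<close>.\<close>

lemma decides_atm:
  assumes "decides (\<lambda>c. kind M (fst c)) (succs M) t h c b"
  shows "halts_within M t c \<and> alt_ok M t c (Suc h) \<and> acc M t c = b"
  using assms
proof (induction rule: decides.induct)
  case (accept c t h)
  then show ?case by (cases t) (auto simp: halting_def)
next
  case (reject c t h)
  then show ?case by (cases t) (auto simp: halting_def)
next
  case (branch c t g f h)
  have alt: "if halting M c' \<or> kind M (fst c') = kind M (fst c) then alt_ok M t c' (Suc h)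
         else 2 \<le> Suc h \<and> alt_ok M t c' (Suc h - 1)" if "c' \<in> succs M c" for c'
  proof -
    have "alt_ok M t c' (Suc (g c'))"
      "g c' + alt_cost (kind M (fst c)) (kind M (fst c')) \<le> h"
      using branch that by auto
    then show ?thesis
      by (auto simp: alt_cost_def halting_def split: if_splits intro: alt_ok_mono)
  qed
  have "kind M (fst c) = Exist \<or> kind M (fst c) = Univ" using branch by auto
  then show ?case
  proof
    assume k: "kind M (fst c) = Exist"
    then have "\<not> halting M c" by (simp add: halting_def)
    moreover have "acc M t c' = f c'" "halts_within M t c'" if "c' \<in> succs M c" for c'
      using branch that by blast+
    ultimately show ?thesis using k alt by (simp add: quant_def) fastforce
  next
    assume k: "kind M (fst c) = Univ"
    then have "\<not> halting M c" by (simp add: halting_def)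
    moreover have "acc M t c' = f c'" "halts_within M t c'" if "c' \<in> succs M c" for c'
      using branch that by blast+
    ultimately show ?thesis using k alt by (simp add: quant_def) fastforce
  qed
qed

section \<open>Stack machines\<close>

datatype 'a action = Keep | Pop | Push 'a

instance action :: (finite) finite
proof
  have "(UNIV :: 'a action set) = {Keep, Pop} \<union> range Push"
    using action.exhaust by auto
  then show "finite (UNIV :: 'a action set)" by (metis finite_Un finite.emptyI finite.insertI finite_imageI finite)
qed

instance skind :: finite
proof
  have "(UNIV :: skind set) = {Exist, Univ, Accept, Reject}"
    using skind.exhaust by auto
  then show "finite (UNIV :: skind set)" by (metis finite.emptyI finite.insertI)
qed

fun perform :: "'a action \<Rightarrow> 'a list \<Rightarrow> 'a list" where
  "perform Keep l = l"
| "perform Pop l = tl l"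
| "perform (Push x) l = x # l"

fun peek :: "'a list \<Rightarrow> 'a option" where
  "peek [] = None"
| "peek (x # l) = Some x"

text \<open>One stack step becomes two sweeps over the tape. The \<open>skind\<close> stored in a
  sweep state is the kind of the state that started the step, so the player does not change during
  the sweeps. Action vector and carried column fit into the control because their types are
  finite.\<close>

datatype ('s, 'a, 'k) micro =
    Init
  | At 's
  | Fwd skind 's "'k \<Rightarrow> 'a action" "'k \<Rightarrow> 'a option"
  | Bwd skind 's "'k \<Rightarrow> 'a action" "'k \<Rightarrow> 'a option"

instance micro :: (finite, finite, finite) finite
proof
  have "(UNIV :: ('a, 'b, 'c) micro set) = {Init} \<union> range At
     \<union> range (\<lambda>(a, b, c, d). Fwd a b c d) \<union> range (\<lambda>(a, b, c, d). Bwd a b c d)"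
    (is "_ = ?R")
  proof -
    have "x \<in> ?R" for x :: "('a, 'b, 'c) micro"
      by (cases x) (auto simp: image_iff)
    then show ?thesis by blast
  qed
  moreover have "finite ?R" by (intro finite_UnI finite_imageI) auto
  ultimately show "finite (UNIV :: ('a, 'b, 'c) micro set)" by simp
qed

section \<open>Simulation of stacks by tracks of one tape\<close>

definition item :: "'a list \<Rightarrow> int \<Rightarrow> 'a option" where
  "item l i = (if 0 \<le> i \<and> i < int (length l) then Some (l ! nat i) else None)"

lemma item_Cons: "item (x # l) i = (if i = 0 then Some x else item l (i - 1))"
  by (auto simp: item_def nth_Cons' nat_diff_distrib)

lemma item_tl: "0 \<le> i \<Longrightarrow> item (tl l) i = item l (i + 1)"
  by (auto simp: item_def nth_tl nat_add_distrib)

lemma item_neg: "i < 0 \<Longrightarrow> item l i = None"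
  by (simp add: item_def)

lemma item_None_iff: "0 \<le> i \<Longrightarrow> item l i = None \<longleftrightarrow> int (length l) \<le> i"
  by (auto simp: item_def)

lemma item_0: "item l 0 = peek l"
  by (cases l) (auto simp: item_def)

locale stack_machine =
  fixes kd :: "'s::finite \<Rightarrow> skind"
    and tr :: "'s \<Rightarrow> ('k::finite \<Rightarrow> 'a::finite option) \<Rightarrow> ('s \<times> ('k \<Rightarrow> 'a action)) set"
    and start :: 's and inp :: 'k and emb :: "sym \<Rightarrow> 'a"
  assumes kd_start: "kd start = Exist" and inj_emb: "inj emb"
begin

definition next_confs :: "'s \<times> ('k \<Rightarrow> 'a list) \<Rightarrow> ('s \<times> ('k \<Rightarrow> 'a list)) set" where
  "next_confs c = (\<lambda>(q', f). (q', \<lambda>k. perform (f k) (snd c k))) ` tr (fst c) (\<lambda>k. peek (snd c k))"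

abbreviation kd_conf :: "'s \<times> ('k \<Rightarrow> 'a list) \<Rightarrow> skind" where
  "kd_conf c \<equiv> kd (fst c)"

fun micro_kind :: "('s, 'a, 'k) micro \<Rightarrow> skind" where
  "micro_kind Init = Exist"
| "micro_kind (At q) = kd q"
| "micro_kind (Fwd \<kappa> q f c) = \<kappa>"
| "micro_kind (Bwd \<kappa> q f c) = \<kappa>"

fun pushed :: "'a action \<Rightarrow> 'a option" where
  "pushed (Push x) = Some x"
| "pushed _ = None"

text \<open>A tape cell holds one entry of every stack; the Boolean flags the cell of the stack tops.
  The forward sweep shifts the pushed stacks to the right, the backward sweep shifts the popped
  stacks to the left; the last component of the state is the carried column.\<close>

fun micro_delta :: "('s, 'a, 'k) micro \<Rightarrow> bool \<times> ('k \<Rightarrow> 'a option)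
    \<Rightarrow> (('s, 'a, 'k) micro \<times> (bool \<times> ('k \<Rightarrow> 'a option)) \<times> int) set" where
  "micro_delta Init a = {(At start, (True, snd a), 0)}"
| "micro_delta (At q) a = (\<lambda>(q', f). (Fwd (kd q) q' f (\<lambda>k. pushed (f k)), a, 0)) ` tr q (snd a)"
| "micro_delta (Fwd \<kappa> q f c) a =
    (if \<forall>k. snd a k = None \<and> c k = None then {(Bwd \<kappa> q f (\<lambda>_. None), a, 0)}
     else {(Fwd \<kappa> q f (\<lambda>k. if pushed (f k) = None then None else snd a k),
            (fst a, \<lambda>k. if pushed (f k) = None then snd a k else c k), 1)})"
| "micro_delta (Bwd \<kappa> q f c) a =
    (let a' = (fst a, \<lambda>k. if f k = Pop then c k else snd a k)
     in if fst a then {(At q, a', 0)} else {(Bwd \<kappa> q f (snd a), a', -1)})"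

fun micro_next :: "('s, 'a, 'k) micro \<times> (int \<Rightarrow> bool \<times> ('k \<Rightarrow> 'a option)) \<times> int
    \<Rightarrow> (('s, 'a, 'k) micro \<times> (int \<Rightarrow> bool \<times> ('k \<Rightarrow> 'a option)) \<times> int) set" where
  "micro_next (m, tp, p) = (\<lambda>(m', b, d). (m', tp(p := b), p + d)) ` micro_delta m (tp p)"

abbreviation micro_kd :: "('s, 'a, 'k) micro \<times> (int \<Rightarrow> bool \<times> ('k \<Rightarrow> 'a option)) \<times> int \<Rightarrow> skind" where
  "micro_kd c \<equiv> micro_kind (fst c)"

definition tape :: "('k \<Rightarrow> 'a list) \<Rightarrow> int \<Rightarrow> bool \<times> ('k \<Rightarrow> 'a option)" where
  "tape \<sigma> = (\<lambda>i. (i = 0, \<lambda>k. item (\<sigma> k) i))"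

text \<open>Here \<open>\<sigma>1\<close> has all pushes done and no pops. Cells right of
  \<open>p\<close> are final, cells up to \<open>p\<close> still show \<open>\<sigma>1\<close>, and
  the carry is the old content of cell \<open>p + 1\<close>, which the popped tracks copy into cell
  \<open>p\<close>. A change of player can only occur in the step to \<open>At q\<close>.\<close>

lemma backward_sweep:
  assumes "\<kappa> \<in> {Exist, Univ}"
    and "decides micro_kd micro_next t g (At q, tape (\<lambda>k. perform (f k) (\<sigma> k)), 0) b"
    and "g + alt_cost \<kappa> (kd q) \<le> h"
    and \<sigma>1: "\<And>k. f k = Pop \<Longrightarrow> \<sigma>1 k = \<sigma> k" "\<And>k. f k \<noteq> Pop \<Longrightarrow> \<sigma>1 k = perform (f k) (\<sigma> k)"
  shows "decides micro_kd micro_next (t + Suc p) h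
    (Bwd \<kappa> q f (\<lambda>k. item (\<sigma>1 k) (int p + 1)),
     \<lambda>i. (i = 0, \<lambda>k. if i \<le> int p then item (\<sigma>1 k) i else item (perform (f k) (\<sigma> k)) i), int p) b"
proof (induction p)
  case 0
  have *: "(\<lambda>i. (i = 0, \<lambda>k. if i \<le> 0 then item (\<sigma>1 k) i else item (perform (f k) (\<sigma> k)) i))
     (0 := (True, \<lambda>k. if f k = Pop then item (\<sigma>1 k) 1 else item (\<sigma>1 k) 0))
     = tape (\<lambda>k. perform (f k) (\<sigma> k))"
  proof -
    have "(if f k = Pop then item (\<sigma>1 k) 1 else item (\<sigma>1 k) 0) = item (perform (f k) (\<sigma> k)) 0"
      "i < 0 \<Longrightarrow> item (\<sigma>1 k) i = item (perform (f k) (\<sigma> k)) i" for k i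
      using \<sigma>1[of k] by (auto simp: item_neg item_tl)
    then show ?thesis by (auto simp: tape_def fun_eq_iff)
  qed
  have "decides micro_kd micro_next (Suc t) h
    (Bwd \<kappa> q f (\<lambda>k. item (\<sigma>1 k) 1),
     \<lambda>i. (i = 0, \<lambda>k. if i \<le> 0 then item (\<sigma>1 k) i else item (perform (f k) (\<sigma> k)) i), 0) b"
    by (rule decides_step[OF _ assms(1) _ assms(2)]) (use assms(3) in \<open>simp_all add: Let_def * cong: if_cong\<close>)
  then show ?case by simp
next
  case (Suc p)
  have *: "(\<lambda>i. (i = 0, \<lambda>k. if i \<le> 1 + int p then item (\<sigma>1 k) i else item (perform (f k) (\<sigma> k)) i))
     (1 + int p := (False, \<lambda>k. if f k = Pop then item (\<sigma>1 k) (int p + 2) else item (\<sigma>1 k) (1 + int p)))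
     = (\<lambda>i. (i = 0, \<lambda>k. if i \<le> int p then item (\<sigma>1 k) i else item (perform (f k) (\<sigma> k)) i))"
  proof -
    have "(if f k = Pop then item (\<sigma>1 k) (int p + 2) else item (\<sigma>1 k) (1 + int p))
        = item (perform (f k) (\<sigma> k)) (1 + int p)" for k
      using \<sigma>1[of k] by (auto simp: item_tl add.commute)
    then show ?thesis by (auto simp: fun_eq_iff)
  qed
  have "decides micro_kd micro_next (Suc (t + Suc p)) h
    (Bwd \<kappa> q f (\<lambda>k. item (\<sigma>1 k) (int p + 2)),
     \<lambda>i. (i = 0, \<lambda>k. if i \<le> 1 + int p then item (\<sigma>1 k) i else item (perform (f k) (\<sigma> k)) i), 1 + int p) b"
    by (rule decides_step[OF _ assms(1) _ Suc]) (simp_all add: Let_def * alt_cost_def add.commute cong: if_cong)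
  then show ?case by (simp add: add.commute)
qed

text \<open>Cells left of \<open>p\<close> show \<open>\<sigma>1\<close>, the others still
  \<open>\<sigma>\<close>; on a pushed track the carry is the symbol due in cell \<open>p\<close>.
  The slack \<open>d\<close> bounds the cells still to be visited, and the budget is
  \<open>d\<close> steps forward, one to turn, and \<open>p + d + 1\<close> back.\<close>

lemma forward_sweep:
  fixes f :: "'k \<Rightarrow> 'a action" and \<sigma> :: "'k \<Rightarrow> 'a list"
  defines "\<sigma>1 \<equiv> \<lambda>k. if f k = Pop then \<sigma> k else perform (f k) (\<sigma> k)"
  assumes \<kappa>: "\<kappa> \<in> {Exist, Univ}"
    and dec: "decides micro_kd micro_next t g (At q, tape (\<lambda>k. perform (f k) (\<sigma> k)), 0) b"
    and g: "g + alt_cost \<kappa> (kd q) \<le> h"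
    and len: "\<And>k. length (\<sigma>1 k) \<le> p + d"
  shows "decides micro_kd micro_next (t + 2 * d + p + 2) h
    (Fwd \<kappa> q f (\<lambda>k. if pushed (f k) = None then None else item (\<sigma>1 k) (int p)),
     \<lambda>i. (i = 0, \<lambda>k. if i < int p then item (\<sigma>1 k) i else item (\<sigma> k) i), int p) b"
  using len
proof (induction d arbitrary: p)
  case 0
  have 1: "item (\<sigma>1 k) i = None" "item (\<sigma> k) i = None" if "i \<ge> int p" for k i
  proof -
    have "length (\<sigma>1 k) \<le> p" using 0[of k] by simp
    moreover have "length (\<sigma> k) \<le> length (\<sigma>1 k)"
      by (cases "f k") (simp_all add: \<sigma>1_def)
    ultimately show "item (\<sigma>1 k) i = None" "item (\<sigma> k) i = None"
      using that by (simp_all add: item_def)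
  qed
  have 2: "item (perform (f k) (\<sigma> k)) i = None" if "i > int p" for k i
    using 1[of i k] 1[of "i + 1" k] that by (cases "f k = Pop") (auto simp: item_tl \<sigma>1_def)
  have *: "(\<lambda>i. (i = 0, \<lambda>k. if i < int p then item (\<sigma>1 k) i else item (\<sigma> k) i))
     = (\<lambda>i. (i = 0, \<lambda>k. if i \<le> int p then item (\<sigma>1 k) i else item (perform (f k) (\<sigma> k)) i))"
  proof -
    have "(if i < int p then item (\<sigma>1 k) i else item (\<sigma> k) i)
      = (if i \<le> int p then item (\<sigma>1 k) i else item (perform (f k) (\<sigma> k)) i)" for i k
      using 1[of i k] 2[of i k] by (cases i "int p" rule: linorder_cases) auto
    then show ?thesis by presburger
  qed
  have c: "(\<lambda>_. None) = (\<lambda>k. item (\<sigma>1 k) (int p + 1))" using 1 by simp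
  have "decides micro_kd micro_next (t + Suc p) h
    (Bwd \<kappa> q f (\<lambda>_. None),
     \<lambda>i. (i = 0, \<lambda>k. if i < int p then item (\<sigma>1 k) i else item (\<sigma> k) i), int p) b"
    unfolding * c by (rule backward_sweep[OF \<kappa> dec g]) (auto simp: \<sigma>1_def)
  then have "decides micro_kd micro_next (Suc (t + Suc p)) h
    (Fwd \<kappa> q f (\<lambda>k. if pushed (f k) = None then None else item (\<sigma>1 k) (int p)),
     \<lambda>i. (i = 0, \<lambda>k. if i < int p then item (\<sigma>1 k) i else item (\<sigma> k) i), int p) b"
    by (rule decides_step[OF _ \<kappa>, rotated 2]) (use 1 in \<open>simp_all add: alt_cost_def fun_upd_idem\<close>)
  then show ?case by simp
next
  case (Suc d)
  let ?tp = "\<lambda>p i. (i = 0, \<lambda>k. if i < int p then item (\<sigma>1 k) i else item (\<sigma> k) i)"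
  let ?c = "\<lambda>p k. if pushed (f k) = None then None else item (\<sigma>1 k) (int p)"
  show ?case
  proof (cases "\<forall>k. item (\<sigma> k) (int p) = None \<and> ?c p k = None")
    case True
    \<comment> \<open>An empty column with an empty carry means that all stacks end before
      \<open>p\<close>: the sweep turns here, and the slack can be lowered without moving.\<close>
    have "length (\<sigma>1 k) \<le> p + 0" for k
      using spec[OF True, of k] item_None_iff[of "int p" "\<sigma>1 k"] item_None_iff[of "int p" "\<sigma> k"]
      by (cases "f k") (simp_all add: \<sigma>1_def)
    then have "length (\<sigma>1 k) \<le> p + d" for k by (meson add_le_cancel_left le_trans zero_le)
    from Suc.IH[OF this] show ?thesis by (rule decides_mono) simp_all
  next
    case False
    have IH: "decides micro_kd micro_next (t + 2 * d + Suc p + 2) h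
       (Fwd \<kappa> q f (?c (Suc p)), ?tp (Suc p), int (Suc p)) b"
      by (rule Suc.IH) (use Suc.prems in simp)
    have c: "?c (Suc p) = (\<lambda>k. if pushed (f k) = None then None else snd (?tp p (int p)) k)"
    proof
      fix k show "?c (Suc p) k = (if pushed (f k) = None then None else snd (?tp p (int p)) k)"
        by (cases "f k") (auto simp: \<sigma>1_def item_Cons)
    qed
    have tp: "?tp (Suc p) = (?tp p)(int p := (fst (?tp p (int p)),
        \<lambda>k. if pushed (f k) = None then snd (?tp p (int p)) k else ?c p k))"
    proof (rule ext, goal_cases)
      case (1 i)
      have "pushed (f k) = None \<Longrightarrow> item (\<sigma>1 k) i = item (\<sigma> k) i" for k
        by (cases "f k") (auto simp: \<sigma>1_def)
      then show ?case by (auto simp: fun_eq_iff)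
    qed
    have "decides micro_kd micro_next (Suc (t + 2 * d + Suc p + 2)) h (Fwd \<kappa> q f (?c p), ?tp p, int p) b"
    proof (rule decides_step[where g = h, OF _ \<kappa> _ IH])
      have "\<not> (\<forall>k. snd (?tp p (int p)) k = None \<and> ?c p k = None)" using False by simp
      then show "micro_next (Fwd \<kappa> q f (?c p), ?tp p, int p)
        = {(Fwd \<kappa> q f (?c (Suc p)), ?tp (Suc p), int (Suc p))}"
        unfolding c tp micro_next.simps micro_delta.simps by (simp only: if_False) simp
    qed (simp_all add: alt_cost_def)
    then show ?thesis by (rule decides_mono) auto
  qed
qed

text \<open>A stack grows by at most one per step, so its height stays within \<open>H + t\<close>,
  and each stack step costs at most \<open>2 * (H + t) + 3\<close> tape steps.\<close>

lemma micro_simulates: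
  assumes "decides kd_conf next_confs t h c b" and "\<And>k. length (snd c k) \<le> H"
  shows "decides micro_kd micro_next (t * (2 * (H + t) + 3)) h (At (fst c), tape (snd c), 0) b"
  using assms
proof (induction arbitrary: H rule: decides.induct)
  case (branch c t g f h)
  let ?A = "tr (fst c) (\<lambda>k. peek (snd c k))"
  let ?B = "\<lambda>(q', o'). (q', \<lambda>k. perform (o' k) (snd c k))"
  let ?T = "t * (2 * (Suc H + t) + 3)"
  let ?e = "\<lambda>(q', o'). (Fwd (kd_conf c) q' o' (\<lambda>k. pushed (o' k)), tape (snd c), 0::int)"
  have peek: "snd (tape (snd c) 0) = (\<lambda>k. peek (snd c k))"
    by (simp add: tape_def item_0)
  have "decides micro_kd micro_next (Suc (?T + 2 * Suc H + 2)) h (At (fst c), tape (snd c), 0)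
      (quant (kd_conf c) ?A (\<lambda>x. f (?B x)))"
  proof (rule decides_image[where e = ?e])
    show "micro_next (At (fst c), tape (snd c), 0) = ?e ` ?A"
      by (simp add: peek image_image case_prod_beta fun_upd_idem)
  next
    fix x assume x: "x \<in> ?A"
    obtain q' o' where x': "x = (q', o')" by (cases x)
    have "?B x \<in> next_confs c" using x by (auto simp: next_confs_def)
    then have IH: "decides micro_kd micro_next ?T (g (?B x))
        (At (fst (?B x)), tape (snd (?B x)), 0) (f (?B x))"
      and g: "g (?B x) + alt_cost (kd_conf c) (kd_conf (?B x)) \<le> h"
    proof -
      assume c': "?B x \<in> next_confs c"
      have "length (snd (?B x) k) \<le> Suc H" for k
        using branch.prems[of k] by (cases "o' k") (auto simp: x')
      with branch c' show "decides micro_kd micro_next ?T (g (?B x))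
        (At (fst (?B x)), tape (snd (?B x)), 0) (f (?B x))"
        and "g (?B x) + alt_cost (kd_conf c) (kd_conf (?B x)) \<le> h"
        by blast+
    qed
    let ?s1 = "\<lambda>k. if o' k = Pop then snd c k else perform (o' k) (snd c k)"
    have len: "length (?s1 k) \<le> 0 + Suc H" for k
      using branch.prems[of k] by (cases "o' k") auto
    have "decides micro_kd micro_next (?T + 2 * Suc H + 0 + 2) h
      (Fwd (kd_conf c) q' o' (\<lambda>k. if pushed (o' k) = None then None else item (?s1 k) (int 0)),
       \<lambda>i. (i = 0, \<lambda>k. if i < int 0 then item (?s1 k) i else item (snd c k) i), int 0) (f (?B x))"
      by (rule forward_sweep[where g = "g (?B x)" and p = 0])
        (use branch.hyps IH g len x' in auto)
    moreover have "(\<lambda>k. if pushed (o' k) = None then None else item (?s1 k) (int 0)) = (\<lambda>k. pushed (o' k))"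
    proof
      fix k show "(if pushed (o' k) = None then None else item (?s1 k) (int 0)) = pushed (o' k)"
        by (cases "o' k") (auto simp: item_Cons)
    qed
    moreover have "(\<lambda>i. (i = 0, \<lambda>k. if i < int 0 then item (?s1 k) i else item (snd c k) i)) = tape (snd c)"
      by (auto simp: tape_def fun_eq_iff item_neg)
    ultimately show "\<exists>g. decides micro_kd micro_next (?T + 2 * Suc H + 2) g (?e x) (f (?B x))
        \<and> g + alt_cost (kd_conf c) (micro_kd (?e x)) \<le> h"
      by (intro exI[of _ h]) (simp add: x' alt_cost_def)
  qed (use branch in auto)
  moreover have "quant (kd_conf c) (next_confs c) f = quant (kd_conf c) ?A (\<lambda>x. f (?B x))"
    by (auto simp: quant_def next_confs_def)
  ultimately show ?case
    by (auto elim!: decides_mono simp: algebra_simps)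
qed (auto intro: decides.intros)

section \<open>Input format and coding of states and columns by numbers\<close>

definition input :: "sym list \<Rightarrow> 'k \<Rightarrow> 'a list" where
  "input w = (\<lambda>k. if k = inp then map emb w else [])"

definition input_column :: "sym option \<Rightarrow> bool \<times> ('k \<Rightarrow> 'a option)" where
  "input_column x = (False, \<lambda>k. if k = inp then map_option emb x else None)"

lemma input_column_inj: "input_column x = input_column y \<longleftrightarrow> x = y"
  using inj_emb by (auto simp: input_column_def fun_eq_iff inj_def option.map_sel
      dest!: spec[of _ inp] intro: option.expand)

lemma decides_from_input:
  assumes "decides kd_conf next_confs t h (start, input w) b"
  shows "decides micro_kd micro_next (Suc (t * (2 * (length w + t) + 3))) h
    (Init, \<lambda>i. input_column (item w i), 0) b"
proof (rule decides_step[where \<kappa> = Exist and g = h])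
  show "decides micro_kd micro_next (t * (2 * (length w + t) + 3)) h
    (At start, tape (input w), 0) b"
    using micro_simulates[OF assms, of "length w"] by (simp add: input_def)
  have "(\<lambda>i. input_column (item w i))(0 := (True, snd (input_column (item w 0)))) = tape (input w)"
    by (auto simp: input_column_def input_def tape_def fun_eq_iff item_def)
  then show "micro_next (Init, \<lambda>i. input_column (item w i), 0) = {(At start, tape (input w), 0)}"
    by simp
qed (auto simp: alt_cost_def kd_start)

text \<open>\<open>init_config\<close> prescribes the codes on the initial tape: 0 for blank and 1
  to 9 for input symbols. The columns that such a tape can show receive exactly these codes; all
  others are moved beyond 9.\<close>

definition column_code :: "bool \<times> ('k \<Rightarrow> 'a option) \<Rightarrow> nat" where
  "column_code = (let e = (SOME e. inj e) in (\<lambda>a.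
     if a \<in> range input_column
     then (case (THE x. a = input_column x) of None \<Rightarrow> 0 | Some s \<Rightarrow> sym_code s)
     else 10 + e a))"

definition state_code :: "('s, 'a, 'k) micro \<Rightarrow> nat" where
  "state_code = (let e = (SOME e. inj e) in (\<lambda>m. if m = Init then 0 else Suc (e m)))"

lemma inj_to_nat: "\<exists>e :: 'z::finite \<Rightarrow> nat. inj e"
  using finite_imp_inj_to_nat_seg[of "UNIV :: 'z set"] by auto

lemma column_code_input:
  "column_code (input_column x) = (case x of None \<Rightarrow> 0 | Some s \<Rightarrow> sym_code s)"
  by (simp add: column_code_def Let_def input_column_inj)

lemma sym_code_bounds: "0 < sym_code s" "sym_code s < 10"
  by (cases s; simp)+

lemma sym_code_inj: "sym_code s = sym_code s' \<longleftrightarrow> s = s'"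
  by (cases s; cases s') auto

lemma inj_column_code: "inj column_code"
proof (rule injI)
  fix a b assume eq: "column_code a = column_code b"
  define e :: "bool \<times> ('k \<Rightarrow> 'a option) \<Rightarrow> nat" where "e = (SOME e. inj e)"
  have e: "inj e" unfolding e_def by (rule someI_ex[OF inj_to_nat])
  have out: "column_code a = 10 + e a" if "a \<notin> range input_column" for a
    using that by (simp add: column_code_def e_def Let_def)
  have small: "column_code (input_column x) < 10" for x
    using sym_code_bounds by (cases x) (auto simp: column_code_input)
  consider "a \<notin> range input_column" "b \<notin> range input_column"
    | x y where "a = input_column x" "b = input_column y"
    | x where "a = input_column x" "b \<notin> range input_column"
    | y where "a \<notin> range input_column" "b = input_column y" by blast
  then show "a = b"
  proof cases
    case 1 then show ?thesis using eq out e by (simp add: inj_eq)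
  next
    case 2
    have "x = y" using eq sym_code_bounds(1)
      by (auto simp: 2 column_code_input sym_code_inj split: option.splits) (metis less_irrefl)+
    then show ?thesis by (simp add: 2)
  next
    case 3 then show ?thesis using eq out[of b] small[of x] by simp
  next
    case 4 then show ?thesis using eq out[of a] small[of y] by simp
  qed
qed

lemma state_code_Init: "state_code Init = 0"
  by (simp add: state_code_def Let_def)

lemma inj_state_code: "inj (state_code :: ('s, 'a, 'k) micro \<Rightarrow> nat)"
proof -
  define e :: "('s, 'a, 'k) micro \<Rightarrow> nat" where "e = (SOME e. inj e)"
  have "inj e" unfolding e_def by (rule someI_ex[OF inj_to_nat])
  moreover have "state_code m = (if m = Init then 0 else Suc (e m))" for m
    by (simp only: state_code_def e_def Let_def)
  ultimately show ?thesis by (auto simp: inj_def split: if_splits)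
qed

definition machine :: atm where
  "machine = \<lparr>nst = Suc (Max (range (state_code :: ('s, 'a, 'k) micro \<Rightarrow> nat))), nsym = 10 + Suc (Max (range column_code)),
     kind = (\<lambda>n. micro_kind (inv state_code n)),
     delta = {(state_code m, column_code a, state_code m', column_code b, d) | m a m' b d.
                (m', b, d) \<in> micro_delta m a}\<rparr>"

lemma wf_machine: "wf_atm machine"
proof -
  have s: "state_code m < Suc (Max (range state_code))" for m :: "('s, 'a, 'k) micro"
    by (simp add: less_Suc_eq_le)
  have c: "column_code a < 10 + Suc (Max (range column_code))" for a
  proof -
    have "column_code a \<le> Max (range column_code)" by (rule Max_ge) simp_all
    then show ?thesis by linarith
  qed
  have d: "(m', b, d) \<in> micro_delta m a \<Longrightarrow> d = -1 \<or> d = 0 \<or> d = 1" for m' b d m a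
    by (cases m) (auto simp: Let_def split: if_splits)
  show ?thesis using s c by (auto simp: wf_atm_def machine_def dest: d)
qed

lemma machine_decides:
  assumes "decides micro_kd micro_next t h (m, tp, p) b"
  shows "decides (\<lambda>c. kind machine (fst c)) (succs machine) t h (state_code m, column_code \<circ> tp, p) b"
proof -
  let ?e = "\<lambda>(m, tp, p). (state_code m, column_code \<circ> tp, p)"
  have "decides (\<lambda>c. kind machine (fst c)) (succs machine) t h (?e (m, tp, p)) b"
  proof (rule decides_map[OF _ _ assms, where e = ?e])
    fix c :: "('s, 'a, 'k) micro \<times> (int \<Rightarrow> bool \<times> ('k \<Rightarrow> 'a option)) \<times> int"
    obtain m tp p where c: "c = (m, tp, p)" by (cases c)
    show "kind machine (fst (?e c)) = micro_kd c"
      by (simp add: c machine_def inv_f_f[OF inj_state_code])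
    have upd: "(column_code \<circ> tp)(p := column_code b) = column_code \<circ> (tp(p := b))" for b
      by (auto simp: fun_eq_iff)
    show "succs machine (?e c) = ?e ` micro_next c"
    proof (intro set_eqI iffI)
      fix x assume "x \<in> succs machine (?e c)"
      then show "x \<in> ?e ` micro_next c"
        by (force simp: c succs_def machine_def upd image_iff
            inj_eq[OF inj_state_code] inj_eq[OF inj_column_code])
    next
      fix x assume "x \<in> ?e ` micro_next c"
      then obtain m' b d where x: "x = ?e (m', tp(p := b), p + d)" and "(m', b, d) \<in> micro_delta m (tp p)"
        by (auto simp: c)
      then have "(state_code m, column_code (tp p), state_code m', column_code b, d) \<in> delta machine"
        unfolding machine_def by (simp del: split_paired_Ex) blast
      then show "x \<in> succs machine (?e c)"
        unfolding x c succs_def by (auto simp: upd[symmetric])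
    qed
  qed
  then show ?thesis by simp
qed

text \<open>The hypothesis on \<open>T\<close> absorbs the simulation overhead for initial stack
  height \<open>n\<close>; the additive \<open>c\<close> in the time bound of
  \<open>ATIME_Sigma\<close> pays for the step out of \<open>Init\<close>.\<close>

theorem stack_machine_ATIME:
  assumes dec: "\<And>w. decides kd_conf next_confs (t (length w)) (h (length w)) (start, input w) (w \<in> L)"
    and T: "\<And>n. t n * (2 * (n + t n) + 3) \<le> c * T n" and c: "1 \<le> c"
  shows "L \<in> ATIME_Sigma T (\<lambda>n. Suc (h n))"
proof -
  have "kind machine 0 = Exist"
    using inv_f_f[OF inj_state_code, of Init] by (simp add: machine_def state_code_Init)
  moreover have "halts_within machine (c * T (length w) + c) (init_config w) \<and>
      alt_ok machine (c * T (length w) + c) (init_config w) (Suc (h (length w))) \<and>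
      (w \<in> L \<longleftrightarrow> acc machine (c * T (length w) + c) (init_config w))" for w
  proof -
    have tp: "column_code \<circ> (\<lambda>i. input_column (item w i)) =
        (\<lambda>i. if 0 \<le> i \<and> i < int (length w) then sym_code (w ! nat i) else 0)"
      by (auto simp: column_code_input item_def)
    have "decides micro_kd micro_next (c * T (length w) + c) (h (length w))
      (Init, \<lambda>i. input_column (item w i), 0) (w \<in> L)"
      by (rule decides_mono[OF decides_from_input[OF dec]]) (use T[of "length w"] c in simp_all)
    from decides_atm[OF machine_decides[OF this]] show ?thesis
      by (simp add: tp init_config_def state_code_Init)
  qed
  ultimately show ?thesis
    unfolding ATIME_Sigma_def Let_def mem_Collect_eq using wf_machine by blast
qed

end

section \<open>The evaluation machine\<close>

text \<open>\<open>Mark\<close> is both the claim in front of an argument and a bit of a table, so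
  claimed values can be compared with table entries symbol by symbol. \<open>HMark\<close> is a
  bottom marker on \<open>StX\<close> and \<open>StB\<close>, below which leftovers of earlier
  rounds may remain. \<open>BEnd\<close> opens each block of a table and is also the unit of the
  yardstick.\<close>

datatype tsym = P sym | Mark bool | HMark bool | HEnd | BEnd | SecEnd

instance sym :: finite
proof
  have "(UNIV :: sym set) = {SZero, SOne, SApp, SAnd, SNeg, SEx, SB0, SB1, SHash}"
    using sym.exhaust by blast
  then show "finite (UNIV :: sym set)" by (metis finite.emptyI finite.insertI)
qed

instance tsym :: finite
proof
  have "(UNIV :: tsym set) = range P \<union> range Mark \<union> range HMark \<union> {HEnd, BEnd, SecEnd}"
    by (auto simp: image_iff) (metis tsym.exhaust)
  then show "finite (UNIV :: tsym set)"
    by (metis finite_Un finite.emptyI finite.insertI finite_imageI finite)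
qed

datatype stk = StS | StE | StX | StB | StY | StZ

instance stk :: finite
proof
  have "(UNIV :: stk set) = {StS, StE, StX, StB, StY, StZ}"
    using stk.exhaust by blast
  then show "finite (UNIV :: stk set)" by (metis finite.emptyI finite.insertI)
qed

text \<open>The stacks: \<open>StS\<close> holds the subformula under consideration, \<open>StE\<close> the environment of guessed
  function tables, \<open>StB\<close> the claimed argument values, \<open>StY\<close> a unary yardstick of length $2^{|w|}$ that
  bounds the guessed tables; \<open>StX\<close> and \<open>StZ\<close> are scratch space.  State \<open>Eval v\<close> stands for the claim that
  \<open>StS\<close> encodes a well-formed formula whose value is \<open>v\<close>.\<close>

datatype st =
    Boot | BLoop | BDup | BDup2 | BBack | BRest
  | Eval bool | Move | Guess | Pick | Skip | Take
  | Check bool | Leaf bool | NotC bool | AndC bool | AndC2 bool bool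
  | AppCheck bool | Arity | Halve bool | Unhalve
  | Find bool | Here bool | Later bool | SkipSec bool | Blocks bool | Cmp bool bool
  | Hdr bool bool bool | Table bool | Rewind bool | PutHdr bool
  | Yes | No

instance st :: finite
proof
  have "(UNIV :: st set) = {Boot, BLoop, BDup, BDup2, BBack, BRest, Move, Guess, Pick, Skip, Take,
      Arity, Unhalve, Yes, No}
    \<union> (range Eval \<union> range Check \<union> range Leaf \<union> range NotC \<union> range AndC \<union> range (case_prod AndC2)
    \<union> range AppCheck \<union> range Halve \<union> range Find \<union> range Here \<union> range Later \<union> range SkipSec
    \<union> range Blocks \<union> range (case_prod Cmp) \<union> range (\<lambda>(a, b, c). Hdr a b c) \<union> range Table
    \<union> range Rewind \<union> range PutHdr)" (is "_ = ?R")
  proof -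
    have "q \<in> ?R" for q by (cases q) (auto simp: image_iff)
    then show ?thesis by blast
  qed
  moreover have "finite ?R" by (intro finite_UnI finite_imageI) auto
  ultimately show "finite (UNIV :: st set)" by simp
qed

type_synonym acts = "tsym action \<times> tsym action \<times> tsym action \<times> tsym action \<times> tsym action \<times> tsym action"

abbreviation goto :: "st \<Rightarrow> st \<times> acts" where
  "goto q \<equiv> (q, Keep, Keep, Keep, Keep, Keep, Keep)"

fun data :: "tsym \<Rightarrow> bool" where
  "data (P a) = True"
| "data (Mark v) = True"
| "data _ = False"

text \<open>Every delimiter reads as the end of a word, like an empty stack, so words with different
  delimiters behind them can be compared directly.\<close>

definition data_top :: "tsym option \<Rightarrow> tsym option" where
  "data_top x = (case x of None \<Rightarrow> None | Some a \<Rightarrow> if data a then Some a else None)"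

definition verdict :: "bool \<Rightarrow> st" where
  "verdict p = (if p then Yes else No)"

text \<open>Guesses are existential and challenges universal; deterministic states are grouped with
  their neighbours to save switches. In \<open>Table v\<close> and \<open>Blocks v\<close> the claim
  decides: a true one asks for one witness, a false one for the failure of all candidates.\<close>

fun st_kind :: "st \<Rightarrow> skind" where
  "st_kind Yes = Accept"
| "st_kind No = Reject"
| "st_kind (Table v) = (if v then Exist else Univ)"
| "st_kind (Blocks v) = (if v then Exist else Univ)"
| "st_kind Pick = Univ" | "st_kind Skip = Univ" | "st_kind Take = Univ"
| "st_kind (Check v) = Univ" | "st_kind (Leaf p) = Univ" | "st_kind (NotC v) = Univ"
| "st_kind (AndC v) = Univ" | "st_kind (AndC2 v x) = Univ" | "st_kind (AppCheck v) = Univ"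
| "st_kind Arity = Univ" | "st_kind (Halve c) = Univ" | "st_kind Unhalve = Univ"
| "st_kind (Here v) = Univ" | "st_kind (Later v) = Univ" | "st_kind (SkipSec v) = Univ"
| "st_kind (Cmp p k) = Univ"
| "st_kind _ = Exist"

text \<open>\<open>Eval\<close> puts \<open>HMark v\<close> on \<open>StX\<close>, where it returns
  \<open>v\<close> once the head is reached, and on \<open>StB\<close> as the bottom of the argument
  values; at a quantifier it separates the key from older parts of \<open>StX\<close>.
  \<open>Move\<close> transfers one symbol without an offer to mark, which excludes an empty head
  and empty arguments. \<open>Pick\<close> meets the arguments last to first: \<open>Skip\<close>
  records a claimed value on \<open>StB\<close>, \<open>Take\<close> restores a string, and a
  challenger who skips even the head loses. In \<open>Halve c\<close> the flag is the parity of the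
  marks popped in this pass; in \<open>Hdr c l v\<close> the flags say that the first
  \<open>SHash\<close> has been passed and that the last digit of the current numeral was
  \<open>SB0\<close>. \<open>Cmp p k\<close> accepts iff the truth value of equality is
  \<open>p\<close>, where \<open>k\<close> selects \<open>StS\<close> or \<open>StB\<close> for
  comparison with \<open>StE\<close>.\<close>

fun step :: "st \<Rightarrow> tsym option \<Rightarrow> tsym option \<Rightarrow> tsym option \<Rightarrow> tsym option \<Rightarrow> tsym option
    \<Rightarrow> tsym option \<Rightarrow> (st \<times> acts) set" where
  "step Boot s e x b y z = {(BLoop, Keep, Keep, Keep, Keep, Push BEnd, Keep)}"
| "step BLoop s e x b y z = (case s of None \<Rightarrow> {goto BRest}
    | Some a \<Rightarrow> {(BDup, Pop, Keep, Push a, Keep, Keep, Keep)})"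
| "step BDup s e x b y z = (case y of None \<Rightarrow> {goto BBack}
    | Some a \<Rightarrow> {(BDup2, Keep, Keep, Keep, Keep, Pop, Push a)})"
| "step BDup2 s e x b y z = {(BDup, Keep, Keep, Keep, Keep, Keep, Push BEnd)}"
| "step BBack s e x b y z = (case z of None \<Rightarrow> {goto BLoop}
    | Some a \<Rightarrow> {(BBack, Keep, Keep, Keep, Keep, Push a, Pop)})"
| "step BRest s e x b y z = (case x of None \<Rightarrow> {goto (Eval True)}
    | Some a \<Rightarrow> {(BRest, Push a, Keep, Pop, Keep, Keep, Keep)})"
| "step (Eval v) s e x b y z =
    (if s = Some (P SEx) then {(Hdr False False v, Pop, Keep, Push (HMark v), Keep, Keep, Keep)}
     else {(Move, Keep, Keep, Push (HMark v), Push (HMark v), Keep, Keep)})"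
| "step Move s e x b y z = (case s of None \<Rightarrow> {goto No}
    | Some a \<Rightarrow> {(Guess, Pop, Keep, Push a, Keep, Keep, Keep)})"
| "step Guess s e x b y z = (case s of None \<Rightarrow> {goto Pick}
    | Some a \<Rightarrow> {(Guess, Pop, Keep, Push a, Keep, Keep, Keep),
        (Move, Keep, Keep, Push (Mark True), Keep, Keep, Keep),
        (Move, Keep, Keep, Push (Mark False), Keep, Keep, Keep)})"
| "step Pick s e x b y z = {goto Skip, goto Take}"
| "step Skip s e x b y z = (case x of
      Some (P a) \<Rightarrow> {(Skip, Keep, Keep, Pop, Keep, Keep, Keep)}
    | Some (Mark v) \<Rightarrow> {(Pick, Keep, Keep, Pop, Push (Mark v), Keep, Keep)}
    | _ \<Rightarrow> {goto Yes})"
| "step Take s e x b y z = (case x of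
      Some (P a) \<Rightarrow> {(Take, Push (P a), Keep, Pop, Keep, Keep, Keep)}
    | Some (Mark v) \<Rightarrow> {(Eval v, Keep, Keep, Pop, Keep, Keep, Keep)}
    | Some (HMark v) \<Rightarrow> {(Check v, Keep, Keep, Pop, Keep, Keep, Keep)}
    | _ \<Rightarrow> {goto No})"
| "step (Check v) s e x b y z = (case s of
      Some (P SZero) \<Rightarrow> {(Leaf (\<not> v), Pop, Keep, Keep, Keep, Keep, Keep)}
    | Some (P SOne) \<Rightarrow> {(Leaf v, Pop, Keep, Keep, Keep, Keep, Keep)}
    | Some (P SNeg) \<Rightarrow> {(NotC v, Pop, Keep, Keep, Keep, Keep, Keep)}
    | Some (P SAnd) \<Rightarrow> {(AndC v, Pop, Keep, Keep, Keep, Keep, Keep)}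
    | Some (P SApp) \<Rightarrow> {(AppCheck v, Pop, Keep, Keep, Keep, Keep, Keep)}
    | _ \<Rightarrow> {goto No})"
| "step (Leaf p) s e x b y z = {goto (verdict (p \<and> s = None \<and> data_top b = None))}"
| "step (NotC v) s e x b y z = (case b of
      Some (Mark u) \<Rightarrow> {(Leaf (v \<noteq> u), Keep, Keep, Keep, Pop, Keep, Keep)}
    | _ \<Rightarrow> {goto No})"
| "step (AndC v) s e x b y z = (case b of
      Some (Mark u) \<Rightarrow> {(AndC2 v u, Keep, Keep, Keep, Pop, Keep, Keep)}
    | _ \<Rightarrow> {goto No})"
| "step (AndC2 v u') s e x b y z = (case b of
      Some (Mark u) \<Rightarrow> {(Leaf (v = (u' \<and> u)), Keep, Keep, Keep, Pop, Keep, Keep)}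
    | _ \<Rightarrow> {goto No})"
| "step (AppCheck v) s e x b y z = {goto Arity, goto (Find v)}"
| "step Arity s e x b y z = (case s of
      Some (P SHash) \<Rightarrow> {(Halve False, Pop, Keep, Keep, Keep, Keep, Keep)}
    | Some (P SB0) \<Rightarrow> {(Arity, Pop, Keep, Keep, Keep, Keep, Keep)}
    | Some (P SB1) \<Rightarrow> {(Arity, Pop, Keep, Keep, Keep, Keep, Keep)}
    | _ \<Rightarrow> {goto No})"
| "step (Halve c) s e x b y z = (case b of
      Some (Mark v) \<Rightarrow> (if c then {(Halve False, Keep, Keep, Keep, Pop, Keep, Push (Mark v))}
                       else {(Halve True, Keep, Keep, Keep, Pop, Keep, Keep)})
    | _ \<Rightarrow> (case s of
        Some (P SHash) \<Rightarrow> {goto (verdict (\<not> c \<and> z = None))}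
      | Some (P SB0) \<Rightarrow> (if \<not> c \<and> z \<noteq> None then {(Unhalve, Pop, Keep, Keep, Keep, Keep, Keep)}
                        else {goto No})
      | Some (P SB1) \<Rightarrow> (if c then {(Unhalve, Pop, Keep, Keep, Keep, Keep, Keep)} else {goto No})
      | _ \<Rightarrow> {goto No}))"
| "step Unhalve s e x b y z = (case z of None \<Rightarrow> {goto (Halve False)}
    | Some a \<Rightarrow> {(Unhalve, Keep, Keep, Keep, Push a, Keep, Pop)})"
| "step (Find v) s e x b y z = (case e of None \<Rightarrow> {goto No} | Some a \<Rightarrow> {goto (Here v), goto (Later v)})"
| "step (Here v) s e x b y z = {goto (Cmp True True), goto (Blocks v)}"
| "step (Later v) s e x b y z = {goto (Cmp False True), goto (SkipSec v)}"
| "step (SkipSec v) s e x b y z = (case e of None \<Rightarrow> {goto No}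
    | Some a \<Rightarrow> {(if a = SecEnd then Find v else SkipSec v, Keep, Pop, Keep, Keep, Keep, Keep)})"
| "step (Blocks v) s e x b y z = (case e of None \<Rightarrow> {goto (verdict (\<not> v))}
    | Some a \<Rightarrow> if a = BEnd then {(Cmp v False, Keep, Pop, Keep, Keep, Keep, Keep),
                                  (Blocks v, Keep, Pop, Keep, Keep, Keep, Keep)}
       else if a = SecEnd then {goto (verdict (\<not> v))}
       else {(Blocks v, Keep, Pop, Keep, Keep, Keep, Keep)})"
| "step (Cmp p k) s e x b y z =
    (if data_top (if k then s else b) \<noteq> data_top e then {goto (verdict (\<not> p))}
     else if data_top e = None then {goto (verdict p)}
     else if k then {(Cmp p k, Pop, Pop, Keep, Keep, Keep, Keep)}
     else {(Cmp p k, Keep, Pop, Keep, Pop, Keep, Keep)})"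
| "step (Hdr c l v) s e x b y z = (case s of
      Some (P SB0) \<Rightarrow> {(Hdr c True v, Pop, Keep, Push (P SB0), Keep, Keep, Keep)}
    | Some (P SB1) \<Rightarrow> {(Hdr c False v, Pop, Keep, Push (P SB1), Keep, Keep, Keep)}
    | Some (P SHash) \<Rightarrow> (if l then {goto No}
        else if c then {(Table v, Pop, Push SecEnd, Push (P SHash), Keep, Keep, Keep)}
        else {(Hdr True False v, Pop, Keep, Push (P SHash), Keep, Keep, Keep)})
    | _ \<Rightarrow> {goto No})"
| "step (Table v) s e x b y z = (case y of None \<Rightarrow> {goto (Rewind v)}
    | Some a \<Rightarrow> {goto (Rewind v),
        (Table v, Keep, Push (Mark True), Keep, Keep, Pop, Push a),
        (Table v, Keep, Push (Mark False), Keep, Keep, Pop, Push a),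
        (Table v, Keep, Push BEnd, Keep, Keep, Pop, Push a)})"
| "step (Rewind v) s e x b y z = (case z of
      None \<Rightarrow> {(PutHdr v, Keep, Push HEnd, Keep, Keep, Keep, Keep)}
    | Some a \<Rightarrow> {(Rewind v, Keep, Keep, Keep, Keep, Push a, Pop)})"
| "step (PutHdr v) s e x b y z = (case x of
      Some (P a) \<Rightarrow> {(PutHdr v, Keep, Push (P a), Pop, Keep, Keep, Keep)}
    | _ \<Rightarrow> {goto (Eval v)})"
| "step Yes s e x b y z = {}"
| "step No s e x b y z = {}"

definition stacks :: "'b \<Rightarrow> 'b \<Rightarrow> 'b \<Rightarrow> 'b \<Rightarrow> 'b \<Rightarrow> 'b \<Rightarrow> stk \<Rightarrow> 'b" where
  "stacks s e x b y z k = (case k of StS \<Rightarrow> s | StE \<Rightarrow> e | StX \<Rightarrow> x | StB \<Rightarrow> b | StY \<Rightarrow> y | StZ \<Rightarrow> z)"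

definition st_trans :: "st \<Rightarrow> (stk \<Rightarrow> tsym option) \<Rightarrow> (st \<times> (stk \<Rightarrow> tsym action)) set" where
  "st_trans q f = (\<lambda>(q', s, e, x, b, y, z). (q', stacks s e x b y z))
     ` step q (f StS) (f StE) (f StX) (f StB) (f StY) (f StZ)"

global_interpretation qm: stack_machine st_kind st_trans Boot StS P
  by unfold_locales (auto simp: inj_def)

section \<open>Rules for single steps of the evaluation machine\<close>

abbreviation run :: "nat \<Rightarrow> nat \<Rightarrow> st \<Rightarrow> tsym list \<Rightarrow> tsym list \<Rightarrow> tsym list \<Rightarrow> tsym list
    \<Rightarrow> tsym list \<Rightarrow> tsym list \<Rightarrow> bool \<Rightarrow> bool" where
  "run t h q s e x b y z v \<equiv> decides qm.kd_conf qm.next_confs t h (q, stacks s e x b y z) v"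

abbreviation run_acts :: "nat \<Rightarrow> nat \<Rightarrow> st \<times> acts \<Rightarrow> tsym list \<Rightarrow> tsym list \<Rightarrow> tsym list \<Rightarrow> tsym list
    \<Rightarrow> tsym list \<Rightarrow> tsym list \<Rightarrow> bool \<Rightarrow> bool" where
  "run_acts t h a s e x b y z v \<equiv> (case a of (q, p1, p2, p3, p4, p5, p6) \<Rightarrow>
     run t h q (perform p1 s) (perform p2 e) (perform p3 x) (perform p4 b) (perform p5 y) (perform p6 z) v)"

lemma next_confs_stacks:
  "qm.next_confs (q, stacks s e x b y z) =
    (\<lambda>(q', p1, p2, p3, p4, p5, p6). (q', stacks (perform p1 s) (perform p2 e) (perform p3 x)
        (perform p4 b) (perform p5 y) (perform p6 z)))
    ` step q (peek s) (peek e) (peek x) (peek b) (peek y) (peek z)"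
proof -
  have "(\<lambda>k. perform (stacks p1 p2 p3 p4 p5 p6 k) (stacks s e x b y z k)) =
    stacks (perform p1 s) (perform p2 e) (perform p3 x) (perform p4 b) (perform p5 y) (perform p6 z)"
    for p1 p2 p3 p4 p5 p6 :: "tsym action"
    by (auto simp: stacks_def fun_eq_iff split: stk.splits)
  then show ?thesis
    by (simp add: qm.next_confs_def st_trans_def image_image case_prod_beta stacks_def[of s e x b y z])
qed

text \<open>\<open>A\<close> pairs each move with the outcome after it; the budgets \<open>t\<close>
  and \<open>g\<close> may differ from move to move.\<close>

lemma run_branch:
  assumes "step q (peek s) (peek e) (peek x) (peek b) (peek y) (peek z) = fst ` A"
    and "st_kind q = \<kappa>" "\<kappa> \<in> {Exist, Univ}"
    and "\<forall>(a, v) \<in> A. \<exists>t g. run_acts t g a s e x b y z v \<and> g + alt_cost \<kappa> (st_kind (fst a)) \<le> h \<and> Suc t \<le> t'"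
    and "w = quant \<kappa> A snd" and "A \<noteq> {}"
  shows "run t' h q s e x b y z w"
proof -
  obtain t'' where t': "t' = Suc t''" using assms(4,6) by (cases t') auto
  show ?thesis unfolding assms(5) t'
  proof (rule decides_image[where e = "\<lambda>((q', p1, p2, p3, p4, p5, p6), v). (q', stacks (perform p1 s)
        (perform p2 e) (perform p3 x) (perform p4 b) (perform p5 y) (perform p6 z))"], goal_cases)
    case (4 av)
    obtain q' p1 p2 p3 p4 p5 p6 v where "av = ((q', p1, p2, p3, p4, p5, p6), v)"
      by (metis prod_cases7 surj_pair)
    with assms(4) 4 show ?case
      by (force simp: t' elim: decides_mono[OF _ _ order_refl])
  qed (use assms in \<open>auto simp: next_confs_stacks image_image case_prod_beta\<close>)
qed

lemma run_step:
  assumes "step q (peek s) (peek e) (peek x) (peek b) (peek y) (peek z) = {a}"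
    and "st_kind q \<in> {Exist, Univ}"
    and "run_acts t g a s e x b y z v" and "g + alt_cost (st_kind q) (st_kind (fst a)) \<le> h" and "Suc t \<le> t'"
  shows "run t' h q s e x b y z v"
  by (rule run_branch[where A = "{(a, v)}", OF _ refl]) (use assms in \<open>auto simp: quant_def\<close>)

lemma run_step2:
  assumes "step q (peek s) (peek e) (peek x) (peek b) (peek y) (peek z) = {aL, aR}"
    and "st_kind q \<in> {Exist, Univ}"
    and "run_acts tL gL aL s e x b y z vL" and "run_acts tR gR aR s e x b y z vR"
    and "gL + alt_cost (st_kind q) (st_kind (fst aL)) \<le> h" and "gR + alt_cost (st_kind q) (st_kind (fst aR)) \<le> h"
    and "Suc tL \<le> t'" and "Suc tR \<le> t'"
    and "v = (if st_kind q = Univ then vL \<and> vR else vL \<or> vR)"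
  shows "run t' h q s e x b y z v"
  by (rule run_branch[where A = "{(aL, vL), (aR, vR)}", OF _ refl]) (use assms in \<open>auto simp: quant_def\<close>)

lemma run_Yes: "run t h Yes s e x b y z True"
  and run_No: "run t h No s e x b y z False"
  by (auto intro: decides.accept decides.reject)

lemma run_halt:
  assumes "step q (peek s) (peek e) (peek x) (peek b) (peek y) (peek z) = {goto (verdict p)}"
    and "st_kind q \<in> {Exist, Univ}" and "1 \<le> t"
  shows "run t h q s e x b y z p"
  by (rule run_step[OF assms(1,2), where t = 0 and g = h])
    (use assms(3) in \<open>auto simp: verdict_def alt_cost_def run_Yes run_No\<close>)

lemma run_accept:
  assumes "step q (peek s) (peek e) (peek x) (peek b) (peek y) (peek z) = {goto Yes}"
    and "st_kind q \<in> {Exist, Univ}" and "1 \<le> t"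
  shows "run t h q s e x b y z True"
  by (rule run_halt) (use assms in \<open>auto simp: verdict_def\<close>)

lemma run_reject:
  assumes "step q (peek s) (peek e) (peek x) (peek b) (peek y) (peek z) = {goto No}"
    and "st_kind q \<in> {Exist, Univ}" and "1 \<le> t"
  shows "run t h q s e x b y z False"
  by (rule run_halt) (use assms in \<open>auto simp: verdict_def\<close>)

lemma alt_cost_simps [simp]:
  "alt_cost \<kappa> \<kappa> = 0" "alt_cost \<kappa> Accept = 0" "alt_cost \<kappa> Reject = 0"
  "alt_cost Exist Univ = 1" "alt_cost Univ Exist = 1"
  by (auto simp: alt_cost_def)

lemma alt_cost_le: "alt_cost \<kappa> \<kappa>' \<le> 1"
  by (auto simp: alt_cost_def)

lemma data_top_simps [simp]:
  "data_top None = None" "data_top (Some (P a)) = Some (P a)" "data_top (Some (Mark v)) = Some (Mark v)"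
  "data_top (Some (HMark v)) = None" "data_top (Some HEnd) = None" "data_top (Some BEnd) = None"
  "data_top (Some SecEnd) = None"
  by (auto simp: data_top_def)

lemma data_top_data: "data a \<Longrightarrow> data_top (Some a) = Some a"
  by (simp add: data_top_def)

section \<open>Comparing words and looking up tables\<close>

lemma run_compare:
  assumes "list_all data u" "list_all data u'" "data_top (peek r) = None" "data_top (peek r') = None"
    and "(if k then s else b) = u @ r"
  shows "run (length u + 1) h (Cmp p k) s (u' @ r') x b y z (p = (u = u'))"
  using assms
proof (induction u arbitrary: u' s b)
  case Nil
  then have 1: "data_top (if k then peek s else peek b) = None" by (auto split: if_splits)
  show ?case
  proof (cases u')
    case u': Nil
    have "run (length [] + 1) h (Cmp p k) s (u' @ r') x b y z p"
      by (rule run_halt) (use Nil.prems 1 in \<open>simp_all add: u'\<close>)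
    then show ?thesis by (simp add: u')
  next
    case (Cons a u'')
    have "run (length [] + 1) h (Cmp p k) s (u' @ r') x b y z (\<not> p)"
      by (rule run_halt) (use Nil.prems 1 in \<open>simp_all add: Cons data_top_data\<close>)
    then show ?thesis by (simp add: Cons)
  qed
next
  case (Cons a u)
  then have 1: "data_top (if k then peek s else peek b) = Some a" by (auto simp: data_top_data)
  show ?case
  proof (cases "\<exists>u''. u' = a # u''")
    case True
    then obtain u'' where u': "u' = a # u''" by blast
    have IH: "run (length u + 1) h (Cmp p k) (if k then tl s else s) (u'' @ r') x (if k then b else tl b) y z (p = (u = u''))"
      by (rule Cons.IH) (use Cons.prems in \<open>auto simp: u'\<close>)
    have "run (length (a # u) + 1) h (Cmp p k) s (u' @ r') x b y z (p = (u = u''))"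
      by (rule run_step[where a = "(Cmp p k, if k then Pop else Keep, Pop, Keep, if k then Keep else Pop, Keep, Keep)"])
        (use Cons.prems 1 IH in \<open>auto simp: u' data_top_data\<close>)
    then show ?thesis by (simp add: u')
  next
    case False
    have "run (length (a # u) + 1) h (Cmp p k) s (u' @ r') x b y z (\<not> p)"
    proof (rule run_halt)
      have "data_top (peek (u' @ r')) \<noteq> Some a"
        using Cons.prems False by (cases u') (auto simp: data_top_data)
      then show "step (Cmp p k) (peek s) (peek (u' @ r')) (peek x) (peek b) (peek y) (peek z) = {goto (verdict (\<not> p))}"
        using 1 by auto
    qed auto
    moreover have "(p = (a # u = u')) = (\<not> p)" using False by auto
    ultimately show ?thesis by simp
  qed
qed

text \<open>A block runs from its \<open>BEnd\<close> to the next symbol that is not data. Whatever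
  precedes the first \<open>BEnd\<close> is ignored, be it stray bits or the key of the
  section.\<close>

fun memb :: "bool list \<Rightarrow> tsym list \<Rightarrow> bool" where
  "memb bs [] = False"
| "memb bs (a # l) = (a = BEnd \<and> takeWhile data l = map Mark bs \<or> memb bs l)"

lemma peek_dropWhile_data: "data_top (peek (dropWhile data l)) = None"
  by (induction l) (auto simp: data_top_def)

lemma list_all_takeWhile: "list_all p (takeWhile p l)"
  by (induction l) auto

lemma list_all_data_map [simp]: "list_all data (map P s)" "list_all data (map Mark bs)"
  by (simp_all add: list.pred_set)

lemma takeWhile_data_append: "\<not> data a \<Longrightarrow> takeWhile data (l @ a # r) = takeWhile data l"
  by (induction l) auto

text \<open>At each \<open>BEnd\<close> the owner of \<open>Blocks v\<close> either compares the
  block that follows or moves on: some block must match if \<open>v\<close>, none may match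
  otherwise. Comparisons are universal, which accounts for the one switch.\<close>

lemma run_blocks:
  assumes "SecEnd \<notin> set l"
  shows "run (length l + length bs + 1) 1 (Blocks v) s (l @ SecEnd # r) x (map Mark bs @ HMark u # b) y z
    (memb bs l = v)"
  using assms
proof (induction l)
  case Nil
  have "run (length [] + length bs + 1) 1 (Blocks v) s ([] @ SecEnd # r) x (map Mark bs @ HMark u # b) y z (\<not> v)"
    by (rule run_halt) auto
  then show ?case by simp
next
  case (Cons a l)
  then have IH: "run (length l + length bs + 1) 1 (Blocks v) s (l @ SecEnd # r) x (map Mark bs @ HMark u # b) y z
    (memb bs l = v)" by simp
  show ?case
  proof (cases "a = BEnd")
    case True
    let ?l = "l @ SecEnd # r"
    have "run (length (map Mark bs) + 1) 0 (Cmp v False) s (takeWhile data ?l @ dropWhile data ?l) x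
      (map Mark bs @ HMark u # b) y z (v = (map Mark bs = takeWhile data ?l))"
      by (rule run_compare[where r = "HMark u # b"])
        (simp_all add: peek_dropWhile_data list_all_takeWhile del: takeWhile_dropWhile_id)
    \<comment> \<open>The block stops at \<open>SecEnd\<close> at the latest, so cutting it out of
      the whole stack or out of \<open>l\<close> gives the same word.\<close>
    then have cmp: "run (length bs + 1) 0 (Cmp v False) s ?l x
      (map Mark bs @ HMark u # b) y z (v = (map Mark bs = takeWhile data l))"
      by (simp only: takeWhile_dropWhile_id length_map) (simp add: takeWhile_data_append)
    show ?thesis
      by (rule run_step2[where aL = "(Cmp v False, Keep, Pop, Keep, Keep, Keep, Keep)"
            and aR = "(Blocks v, Keep, Pop, Keep, Keep, Keep, Keep)" and tL = "length bs + 1"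
            and tR = "length l + length bs + 1" and gL = 0 and gR = 1])
        (use True IH cmp in \<open>auto simp: alt_cost_le\<close>)
  next
    case False
    show ?thesis
      by (rule run_step[where a = "(Blocks v, Keep, Pop, Keep, Keep, Keep, Keep)"])
        (use Cons.prems False IH in auto)
  qed
qed

text \<open>A section of the environment consists of the key of a function variable and a list of
  blocks; the function is true exactly on the bit strings occurring as blocks, so every string
  over the guessed alphabet denotes a function.  The first matching section counts.\<close>

type_synonym env = "(sym list \<times> tsym list) list"

definition enc_env :: "env \<Rightarrow> tsym list" where
  "enc_env \<rho> = concat (map (\<lambda>(k, l). map P k @ HEnd # l @ [SecEnd]) \<rho>)"

definition ok_env :: "env \<Rightarrow> bool" where
  "ok_env \<rho> \<longleftrightarrow> (\<forall>(k, l) \<in> set \<rho>. SecEnd \<notin> set l)"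

text \<open>The claimed value is an argument of the lookup so that an unbound key fails for both
  values.\<close>

fun look :: "sym list \<Rightarrow> bool list \<Rightarrow> bool \<Rightarrow> env \<Rightarrow> bool" where
  "look k bs v [] = False"
| "look k bs v ((k', l) # \<rho>) = (if k = k' then memb bs l = v else look k bs v \<rho>)"

text \<open>Lets \<open>Blocks\<close> start at the top of a section, with the key still in
  front.\<close>

lemma memb_header: "memb bs (map P k @ HEnd # l) = memb bs l"
  by (induction k) auto

lemma run_skip_section:
  assumes "SecEnd \<notin> set l" "run t g (Find v) s r x b y z w"
  shows "run (t + length l + 1) (g + 1) (SkipSec v) s (l @ SecEnd # r) x b y z w"
  using assms(1)
proof (induction l)
  case Nil
  show ?case
    by (rule run_step[where a = "(Find v, Keep, Pop, Keep, Keep, Keep, Keep)" and t = t and g = g])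
      (use assms in auto)
next
  case (Cons a l)
  then have "run (t + length l + 1) (g + 1) (SkipSec v) s (l @ SecEnd # r) x b y z w" by simp
  then show ?case
    by - (rule run_step[where a = "(SkipSec v, Keep, Pop, Keep, Keep, Keep, Keep)"
        and t = "t + length l + 1" and g = "g + 1"], use Cons.prems in auto)
qed

lemma inj_P: "inj P"
  by (simp add: inj_def)

text \<open>The existential player says whether the first section matches; the universal player
  tests this or lets the play go on, on a fresh copy of the stacks. A skipped section costs two
  switches, the one that is used up to three: into \<open>Here\<close>, into
  \<open>Blocks True\<close>, into \<open>Cmp\<close>.\<close>

lemma run_find:
  assumes "ok_env \<rho>"
  shows "run (2 * length (enc_env \<rho>) + length k + length bs + 4) (2 * length \<rho> + 1) (Find v) (map P k)
    (enc_env \<rho>) x (map Mark bs @ HMark u # b) y z (look k bs v \<rho>)"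
  using assms
proof (induction \<rho>)
  case Nil
  show ?case by (simp, rule run_reject) (auto simp: enc_env_def)
next
  case (Cons kl \<rho>)
  obtain k' l where kl: "kl = (k', l)" by (cases kl)
  let ?B = "map Mark bs @ HMark u # b"
  let ?sec = "map P k' @ HEnd # l"
  let ?E = "enc_env (kl # \<rho>)"
  have E: "?E = map P k' @ HEnd # l @ SecEnd # enc_env \<rho>" "?E = ?sec @ SecEnd # enc_env \<rho>"
    by (simp_all add: enc_env_def kl)
  have sec: "SecEnd \<notin> set ?sec" using Cons.prems by (auto simp: ok_env_def kl)
  have IH: "run (2 * length (enc_env \<rho>) + length k + length bs + 4) (2 * length \<rho> + 1) (Find v) (map P k)
    (enc_env \<rho>) x ?B y z (look k bs v \<rho>)"
    using Cons by (simp add: ok_env_def)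
  have cmp: "run (length k + 1) 0 (Cmp p True) (map P k) ?E x ?B y z (p = (k = k'))" for p
  proof -
    have "run (length (map P k) + 1) 0 (Cmp p True) (map P k) (map P k' @ HEnd # l @ SecEnd # enc_env \<rho>) x ?B y z
      (p = (map P k = map P k'))"
      by (rule run_compare[where r = "[]"]) auto
    then show ?thesis by (simp add: E(1) inj_map_eq_map[OF inj_P])
  qed
  have blocks: "run (length ?sec + length bs + 1) 1 (Blocks v) (map P k) ?E x ?B y z (memb bs l = v)"
    using run_blocks[OF sec, of bs v "map P k" "enc_env \<rho>" x u b y z] by (simp only: E(2) memb_header)
  have here: "run (length ?sec + length k + length bs + 2) 2 (Here v) (map P k) ?E x ?B y z
      ((k = k') \<and> memb bs l = v)"
    by (rule run_step2[where aL = "goto (Cmp True True)" and aR = "goto (Blocks v)"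
          and tL = "length k + 1" and tR = "length ?sec + length bs + 1" and gL = 0 and gR = 1])
      (use cmp[of True] blocks in \<open>auto simp: alt_cost_le\<close>)
  have skip: "run (2 * length (enc_env \<rho>) + length k + length bs + 4 + length ?sec + 1) (2 * length \<rho> + 1 + 1)
      (SkipSec v) (map P k) ?E x ?B y z (look k bs v \<rho>)"
    unfolding E(2) by (rule run_skip_section[OF sec IH])
  have later: "run (2 * length (enc_env \<rho>) + length k + length bs + 4 + length ?sec + 2) (2 * length \<rho> + 1 + 1)
      (Later v) (map P k) ?E x ?B y z (k \<noteq> k' \<and> look k bs v \<rho>)"
    by (rule run_step2[where aL = "goto (Cmp False True)" and aR = "goto (SkipSec v)"
          and tL = "length k + 1" and tR = "2 * length (enc_env \<rho>) + length k + length bs + 4 + length ?sec + 1"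
          and gL = 0 and gR = "2 * length \<rho> + 1 + 1"])
      (use cmp[of False] skip in \<open>auto\<close>)
  obtain a where a: "peek ?E = Some a" unfolding E by (cases k') auto
  have len: "length ?E = length k' + length l + 2 + length (enc_env \<rho>)" by (simp add: E(1))
  show ?case
    by (rule run_step2[where aL = "goto (Here v)" and aR = "goto (Later v)"
          and tL = "length ?sec + length k + length bs + 2"
          and tR = "2 * length (enc_env \<rho>) + length k + length bs + 4 + length ?sec + 2"
          and gL = 2 and gR = "2 * length \<rho> + 1 + 1"])
      (use here[unfolded kl] later[unfolded kl] a[unfolded kl] len[unfolded kl] in \<open>simp_all add: kl\<close>, auto)
qed

section \<open>Checking the number of arguments against a binary arity\<close>

fun digits_ok :: "sym list \<Rightarrow> nat \<Rightarrow> bool" where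
  "digits_ok (SHash # k) m = (m = 0)"
| "digits_ok (SB0 # k) m = (m \<noteq> 0 \<and> even m \<and> digits_ok k (m div 2))"
| "digits_ok (SB1 # k) m = (odd m \<and> digits_ok k (m div 2))"
| "digits_ok _ m = False"

fun arity_ok :: "sym list \<Rightarrow> nat \<Rightarrow> bool" where
  "arity_ok (SHash # k) m = digits_ok k m"
| "arity_ok (SB0 # k) m = arity_ok k m"
| "arity_ok (SB1 # k) m = arity_ok k m"
| "arity_ok _ m = False"

text \<open>Halving preserves counts, not values, so the continuation is assumed for every vector
  \<open>bs'\<close> of the right length. The values are checked in a separate branch that has its
  own copy.\<close>

lemma run_unhalve:
  assumes "\<And>bs'. length bs' = length zs + length bs \<Longrightarrow> run t h (Halve False) s e x (map Mark bs' @ b) y [] v"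
  shows "run (t + length zs + 1) h Unhalve s e x (map Mark bs @ b) y (map Mark zs) v"
  using assms
proof (induction zs arbitrary: bs)
  case Nil
  show ?case
    by (rule run_step[where a = "goto (Halve False)" and t = t and g = h]) (use Nil in auto)
next
  case (Cons c zs)
  have "run (t + length zs + 1) h Unhalve s e x (map Mark (c # bs) @ b) y (map Mark zs) v"
    by (rule Cons.IH) (use Cons.prems in auto)
  then show ?case
    by - (rule run_step[where a = "(Unhalve, Keep, Keep, Keep, Push (Mark c), Keep, Pop)"
          and t = "t + length zs + 1" and g = h], auto)
qed

text \<open>Every second mark moves to \<open>StZ\<close> and \<open>c\<close> records a pending
  one, so twice the length of \<open>zs\<close>, plus \<open>c\<close>, plus the length of
  \<open>bs\<close> is invariant.\<close>

lemma run_halve_loop: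
  assumes "\<And>c' zs'. 2 * length zs' + of_bool c' = 2 * length zs + of_bool c + length bs \<Longrightarrow>
    run t h (Halve c') s e x (HMark u # b) y (map Mark zs') v"
  shows "run (t + length bs) h (Halve c) s e x (map Mark bs @ HMark u # b) y (map Mark zs) v"
  using assms
proof (induction bs arbitrary: c zs)
  case Nil
  show ?case using Nil[of zs c] by simp
next
  case (Cons a bs)
  show ?case
  proof (cases c)
    case True
    have "run (t + length bs) h (Halve False) s e x (map Mark bs @ HMark u # b) y (map Mark (a # zs)) v"
      by (rule Cons.IH) (use Cons.prems True in auto)
    then show ?thesis
      by - (rule run_step[where a = "(Halve False, Keep, Keep, Keep, Pop, Keep, Push (Mark a))"
          and t = "t + length bs" and g = h], auto simp: True)
  next
    case False
    have "run (t + length bs) h (Halve True) s e x (map Mark bs @ HMark u # b) y (map Mark zs) v"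
      by (rule Cons.IH) (use Cons.prems False in auto)
    then show ?thesis
      by - (rule run_step[where a = "(Halve True, Keep, Keep, Keep, Pop, Keep, Keep)"
          and t = "t + length bs" and g = h], auto simp: False)
  qed
qed

text \<open>Numerals start with the least significant digit: each round compares one digit with the
  parity of the count and goes on with half of the marks. The budget allows \<open>2 * n + 2\<close>
  steps per digit, where \<open>n\<close> bounds the marks in every round.\<close>

lemma run_halve:
  assumes "length bs \<le> n"
  shows "run (length bs + (length k + 1) * (2 * n + 2)) h (Halve False) (map P k) e x (map Mark bs @ HMark u # b) y
    [] (digits_ok k (length bs))"
  using assms
proof (induction k arbitrary: bs)
  case (Nil bs)
  have "run (2 * n + 2 + length bs) h (Halve False) (map P []) e x (map Mark bs @ HMark u # b) y (map Mark []) False"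
    by (rule run_halve_loop) (rule run_reject, auto)
  then show ?case by (simp add: add.commute)
next
  case (Cons a k bs)
  let ?t = "(length k + 1) * (2 * n + 2) + 2 * n + 2"
  have *: "run ?t h (Halve c) (map P (a # k)) e x (HMark u # b) y (map Mark zs) (digits_ok (a # k) (length bs))"
    if eq: "2 * length zs + of_bool c = length bs" for c zs
  proof -
    have div: "length bs div 2 = length zs" and odd: "odd (length bs) = c"
      unfolding eq[symmetric] by auto
    have "run (n + (length k + 1) * (2 * n + 2) + length zs + 1) h Unhalve (map P k) e x (map Mark [] @ HMark u # b) y
       (map Mark zs) (digits_ok k (length zs))"
    proof (rule run_unhalve)
      fix bs' :: "bool list" assume "length bs' = length zs + length ([] :: bool list)"
      then have bs': "length bs' = length zs" "length bs' \<le> n" using eq Cons.prems by auto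
      then show "run (n + (length k + 1) * (2 * n + 2)) h (Halve False) (map P k) e x (map Mark bs' @ HMark u # b) y []
        (digits_ok k (length zs))"
        using decides_mono[OF Cons.IH[OF bs'(2)], of "n + (length k + 1) * (2 * n + 2)" h] by simp
    qed
    then have unhalve: "run (?t - 1) h Unhalve (map P k) e x (HMark u # b) y (map Mark zs) (digits_ok k (length zs))"
      by simp (elim decides_mono, use eq Cons.prems in auto)
    show ?thesis
    proof (cases "a = SHash \<or> a = SB0 \<and> \<not> c \<and> zs \<noteq> [] \<or> a = SB1 \<and> c")
      case False
      have "run ?t h (Halve c) (map P (a # k)) e x (HMark u # b) y (map Mark zs) False"
        by (rule run_reject) (use False in \<open>cases a; cases c; cases zs; auto\<close>)+
      moreover have "\<not> digits_ok (a # k) (length bs)"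
        using False div odd eq by (cases a) auto
      ultimately show ?thesis by simp
    next
      case True
      then consider "a = SHash" | "a = SB0" "\<not> c" "zs \<noteq> []" | "a = SB1" "c" by blast
      then show ?thesis
      proof cases
        case 1
        have "peek (map Mark zs) = None \<longleftrightarrow> zs = []" by (cases zs) auto
        then have "run ?t h (Halve c) (map P (a # k)) e x (HMark u # b) y (map Mark zs) (\<not> c \<and> zs = [])"
          by - (rule run_halt, use 1 in auto)
        moreover have "digits_ok (a # k) (length bs) = (\<not> c \<and> zs = [])" using 1 eq by auto
        ultimately show ?thesis by simp
      next
        case 2
        obtain z0 zs' where zs: "zs = z0 # zs'" using 2 by (cases zs) auto
        have "digits_ok (a # k) (length bs) = digits_ok k (length zs)"
          using 2 eq div odd by auto
        then show ?thesis
          by - (rule run_step[where a = "(Unhalve, Pop, Keep, Keep, Keep, Keep, Keep)"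
              and t = "?t - 1" and g = h], use 2 unhalve zs in auto)
      next
        case 3
        have "digits_ok (a # k) (length bs) = digits_ok k (length zs)"
          using 3 eq div odd by auto
        then show ?thesis
          by - (rule run_step[where a = "(Unhalve, Pop, Keep, Keep, Keep, Keep, Keep)"
              and t = "?t - 1" and g = h], use 3 unhalve in auto)
      qed
    qed
  qed
  have "run (?t + length bs) h (Halve False) (map P (a # k)) e x (map Mark bs @ HMark u # b) y (map Mark [])
      (digits_ok (a # k) (length bs))"
    by (rule run_halve_loop) (rule *, simp)
  then show ?case by (simp add: algebra_simps)
qed

lemma run_arity:
  assumes "length bs \<le> n"
  shows "run (length bs + (length k + 1) * (2 * n + 3)) h Arity (map P k) e x (map Mark bs @ HMark u # b) y
    [] (arity_ok k (length bs))"
proof (induction k)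
  case Nil
  show ?case by (simp, rule run_reject) auto
next
  case (Cons a k)
  consider "a = SHash" | "a = SB0 \<or> a = SB1" | "a \<notin> {SHash, SB0, SB1}" by blast
  then show ?case
  proof cases
    case 1
    show ?thesis
      by (rule run_step[where a = "(Halve False, Pop, Keep, Keep, Keep, Keep, Keep)" and g = h
            and t = "length bs + (length k + 1) * (2 * n + 2)"])
        (use 1 run_halve[OF assms] in \<open>auto simp: algebra_simps\<close>)
  next
    case 2
    show ?thesis
      by (rule run_step[where a = "(Arity, Pop, Keep, Keep, Keep, Keep, Keep)" and g = h
            and t = "length bs + (length k + 1) * (2 * n + 3)"])
        (use 2 Cons in auto)
  next
    case 3
    then have "\<not> arity_ok (a # k) (length bs)" by (cases a) auto
    moreover have "run (length bs + (length (a # k) + 1) * (2 * n + 3)) h Arity (map P (a # k)) e x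
        (map Mark bs @ HMark u # b) y [] False"
      by (rule run_reject) (use 3 in \<open>auto split: sym.splits\<close>)
    ultimately show ?thesis by simp
  qed
qed

section \<open>Checking the head against the claimed values\<close>

fun head_ok :: "bool \<Rightarrow> sym list \<Rightarrow> bool list \<Rightarrow> env \<Rightarrow> bool" where
  "head_ok v (SZero # s) bs \<rho> = (\<not> v \<and> s = [] \<and> bs = [])"
| "head_ok v (SOne # s) bs \<rho> = (v \<and> s = [] \<and> bs = [])"
| "head_ok v (SNeg # s) bs \<rho> = (s = [] \<and> bs = [\<not> v])"
| "head_ok v (SAnd # s) bs \<rho> = (s = [] \<and> (\<exists>u u'. bs = [u, u'] \<and> v = (u \<and> u')))"
| "head_ok v (SApp # s) bs \<rho> = (arity_ok s (length bs) \<and> look s bs v \<rho>)"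
| "head_ok v _ bs \<rho> = False"

lemma peek_map_None: "peek (map f l) = None \<longleftrightarrow> l = []"
  by (cases l) auto

lemma data_top_marks: "data_top (peek (map Mark bs @ HMark u # b)) = None \<longleftrightarrow> bs = []"
  by (cases bs) auto

lemma run_leaf:
  "run 1 h (Leaf p) (map P s) e x (map Mark bs @ HMark u # b) y z (p \<and> s = [] \<and> bs = [])"
  by (rule run_halt) (auto simp: peek_map_None data_top_marks)

lemma run_not:
  "run 2 h (NotC v) (map P s) e x (map Mark bs @ HMark u # b) y z (s = [] \<and> bs = [\<not> v])"
proof (cases bs)
  case Nil
  have "run 2 h (NotC v) (map P s) e x (map Mark bs @ HMark u # b) y z False"
    by (rule run_reject) (auto simp: Nil)
  then show ?thesis by (simp add: Nil)
next
  case (Cons c bs')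
  have "run 2 h (NotC v) (map P s) e x (map Mark bs @ HMark u # b) y z ((v \<noteq> c) \<and> s = [] \<and> bs' = [])"
    by (rule run_step[where a = "(Leaf (v \<noteq> c), Keep, Keep, Keep, Pop, Keep, Keep)" and t = 1 and g = h])
      (use run_leaf[where p = "v \<noteq> c"] in \<open>auto simp: Cons\<close>)
  moreover have "((v \<noteq> c) \<and> s = [] \<and> bs' = []) = (s = [] \<and> bs = [\<not> v])" by (auto simp: Cons)
  ultimately show ?thesis by simp
qed

lemma run_and2:
  "run 2 h (AndC2 v c) (map P s) e x (map Mark bs @ HMark u # b) y z
    (s = [] \<and> (\<exists>u'. bs = [u'] \<and> v = (c \<and> u')))"
proof (cases bs)
  case Nil
  have "run 2 h (AndC2 v c) (map P s) e x (map Mark bs @ HMark u # b) y z False"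
    by (rule run_reject) (auto simp: Nil)
  then show ?thesis by (simp add: Nil)
next
  case (Cons d bs')
  have "run 2 h (AndC2 v c) (map P s) e x (map Mark bs @ HMark u # b) y z ((v = (c \<and> d)) \<and> s = [] \<and> bs' = [])"
    by (rule run_step[where a = "(Leaf (v = (c \<and> d)), Keep, Keep, Keep, Pop, Keep, Keep)" and t = 1 and g = h])
      (use run_leaf[where p = "v = (c \<and> d)"] in \<open>auto simp: Cons\<close>)
  moreover have "((v = (c \<and> d)) \<and> s = [] \<and> bs' = []) = (s = [] \<and> (\<exists>u'. bs = [u'] \<and> v = (c \<and> u')))"
    by (auto simp: Cons)
  ultimately show ?thesis by simp
qed

lemma run_and:
  "run 3 h (AndC v) (map P s) e x (map Mark bs @ HMark u # b) y z
    (s = [] \<and> (\<exists>u u'. bs = [u, u'] \<and> v = (u \<and> u')))"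
proof (cases bs)
  case Nil
  have "run 3 h (AndC v) (map P s) e x (map Mark bs @ HMark u # b) y z False"
    by (rule run_reject) (auto simp: Nil)
  then show ?thesis by (simp add: Nil)
next
  case (Cons c bs')
  have "run 3 h (AndC v) (map P s) e x (map Mark bs @ HMark u # b) y z
    (s = [] \<and> (\<exists>u'. bs' = [u'] \<and> v = (c \<and> u')))"
    by (rule run_step[where a = "(AndC2 v c, Keep, Keep, Keep, Pop, Keep, Keep)" and t = 2 and g = h])
      (use run_and2 in \<open>auto simp: Cons\<close>)
  moreover have "(s = [] \<and> (\<exists>u'. bs' = [u'] \<and> v = (c \<and> u'))) = (s = [] \<and> (\<exists>u u'. bs = [u, u'] \<and> v = (u \<and> u')))"
    by (auto simp: Cons)
  ultimately show ?thesis by simp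
qed

text \<open>The quadratic term pays for the arity check, the term in \<open>enc_env \<rho>\<close>
  for the lookup; the challenger picks one of them, so either may consume \<open>StB\<close>. The
  switch beyond those of \<open>run_find\<close> leads from the universal \<open>AppCheck\<close> to
  \<open>Find\<close>.\<close>

lemma run_check:
  assumes "ok_env \<rho>" "length bs \<le> n" "length s \<le> n + 1"
  shows "run (2 * length (enc_env \<rho>) + n + (n + 1) * (2 * n + 4) + 8) (2 * length \<rho> + 2) (Check v) (map P s)
    (enc_env \<rho>) x (map Mark bs @ HMark u # b) y [] (head_ok v s bs \<rho>)"
proof (cases s)
  case Nil
  show ?thesis unfolding Nil by (simp, rule run_reject) auto
next
  case (Cons a k)
  let ?t = "2 * length (enc_env \<rho>) + n + (n + 1) * (2 * n + 4) + 8"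
  let ?h = "2 * length \<rho> + 2"
  let ?B = "map Mark bs @ HMark u # b"
  show ?thesis
  proof (cases a)
    case SZero
    show ?thesis
      by (rule run_step[where a = "(Leaf (\<not> v), Pop, Keep, Keep, Keep, Keep, Keep)" and t = 1 and g = ?h])
        (use run_leaf[where p = "\<not> v"] in \<open>auto simp: SZero Cons\<close>)
  next
    case SOne
    show ?thesis
      by (rule run_step[where a = "(Leaf v, Pop, Keep, Keep, Keep, Keep, Keep)" and t = 1 and g = ?h])
        (use run_leaf[where p = v] in \<open>auto simp: SOne Cons\<close>)
  next
    case SNeg
    show ?thesis
      by (rule run_step[where a = "(NotC v, Pop, Keep, Keep, Keep, Keep, Keep)" and t = 2 and g = ?h])
        (use run_not in \<open>auto simp: SNeg Cons\<close>)
  next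
    case SAnd
    show ?thesis
      by (rule run_step[where a = "(AndC v, Pop, Keep, Keep, Keep, Keep, Keep)" and t = 3 and g = ?h])
        (use run_and in \<open>auto simp: SAnd Cons\<close>)
  next
    case SApp
    have k: "length k \<le> n" using assms(3) by (simp add: Cons)
    have "run (length bs + (length k + 1) * (2 * n + 3)) 0 Arity (map P k) (enc_env \<rho>) x ?B y [] (arity_ok k (length bs))"
      by (rule run_arity[OF assms(2)])
    moreover have "length bs + (length k + 1) * (2 * n + 3) \<le> n + (n + 1) * (2 * n + 4)"
      using assms(2) k by (intro add_mono mult_mono) auto
    ultimately have "run (2 * length (enc_env \<rho>) + n + (n + 1) * (2 * n + 4) + 4) 0 Arity (map P k) (enc_env \<rho>) x ?B y [] (arity_ok k (length bs))"
      by (elim decides_mono) auto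
    moreover have "run (2 * length (enc_env \<rho>) + n + (n + 1) * (2 * n + 4) + 4) (2 * length \<rho> + 1) (Find v) (map P k)
        (enc_env \<rho>) x ?B y [] (look k bs v \<rho>)"
      by (rule decides_mono[OF run_find[OF assms(1)]]) (use assms(2) k in auto)
    ultimately have "run (2 * length (enc_env \<rho>) + n + (n + 1) * (2 * n + 4) + 5) ?h (AppCheck v) (map P k) (enc_env \<rho>) x ?B y []
        (arity_ok k (length bs) \<and> look k bs v \<rho>)"
      by - (rule run_step2[where aL = "goto Arity" and aR = "goto (Find v)"
            and tL = "2 * length (enc_env \<rho>) + n + (n + 1) * (2 * n + 4) + 4"
            and tR = "2 * length (enc_env \<rho>) + n + (n + 1) * (2 * n + 4) + 4" and gL = 0 and gR = "2 * length \<rho> + 1"], auto)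
    then show ?thesis
      by - (rule run_step[where a = "(AppCheck v, Pop, Keep, Keep, Keep, Keep, Keep)"
          and t = "2 * length (enc_env \<rho>) + n + (n + 1) * (2 * n + 4) + 5" and g = ?h], auto simp: SApp Cons)
  qed (use Cons in \<open>auto intro!: run_reject\<close>)
qed

section \<open>Challenging an argument or the head\<close>

lemma run_take_piece:
  assumes "run t g (Eval u) (map P p @ s) e x b y z w"
  shows "run (t + length p + 1) (g + 1) Take s e (rev (map P p) @ Mark u # x) b y z w"
  using assms
proof (induction p arbitrary: s rule: rev_induct)
  case Nil
  show ?case
    by (rule run_step[where a = "(Eval u, Keep, Keep, Pop, Keep, Keep, Keep)" and t = t and g = g])
      (use Nil in auto)
next
  case (snoc a p)
  have "run (t + length p + 1) (g + 1) Take (P a # s) e (rev (map P p) @ Mark u # x) b y z w"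
    by (rule snoc.IH) (use snoc.prems in simp)
  then show ?case
    by - (rule run_step[where a = "(Take, Push (P a), Keep, Pop, Keep, Keep, Keep)"
        and t = "t + length p + 1" and g = "g + 1"], auto)
qed

lemma run_take_head:
  assumes "run t g (Check u) (map P p @ s) e x b y z w"
  shows "run (t + length p + 1) g Take s e (rev (map P p) @ HMark u # x) b y z w"
  using assms
proof (induction p arbitrary: s rule: rev_induct)
  case Nil
  show ?case
    by (rule run_step[where a = "(Check u, Keep, Keep, Pop, Keep, Keep, Keep)" and t = t and g = g])
      (use Nil in auto)
next
  case (snoc a p)
  have "run (t + length p + 1) g Take (P a # s) e (rev (map P p) @ HMark u # x) b y z w"
    by (rule snoc.IH) (use snoc.prems in simp)
  then show ?case
    by - (rule run_step[where a = "(Take, Push (P a), Keep, Pop, Keep, Keep, Keep)"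
        and t = "t + length p + 1" and g = g], auto)
qed

lemma run_skip_piece:
  assumes "run t g Pick s e x (Mark u # b) y z w"
  shows "run (t + length p + 1) g Skip s e (rev (map P p) @ Mark u # x) b y z w"
proof (induction p rule: rev_induct)
  case Nil
  show ?case
    by (rule run_step[where a = "(Pick, Keep, Keep, Pop, Push (Mark u), Keep, Keep)" and t = t and g = g])
      (use assms in auto)
next
  case (snoc a p)
  then show ?case
    by - (rule run_step[where a = "(Skip, Keep, Keep, Pop, Keep, Keep, Keep)"
        and t = "t + length p + 1" and g = g], auto)
qed

text \<open>A universal player who skips the head has let every claim pass and concedes.\<close>

lemma run_skip_head:
  "run (length p + 1) g Skip s e (rev (map P p) @ HMark u # x) b y z True"
proof (induction p rule: rev_induct)
  case Nil
  show ?case by (rule run_accept) auto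
next
  case (snoc a p)
  then show ?case
    by - (rule run_step[where a = "(Skip, Keep, Keep, Pop, Keep, Keep, Keep)"
        and t = "length p + 1" and g = g], auto)
qed

definition piece :: "bool \<times> sym list \<Rightarrow> tsym list" where
  "piece = (\<lambda>(u, p). Mark u # map P p)"

text \<open>Since \<open>StX\<close> is reversed, the arguments appear last to first. Whoever skips
  them all and takes the head finds the claimed values on \<open>StB\<close> in their original
  order, which is the situation of \<open>Check\<close>. The first premise ranges over all
  \<open>x\<close> and \<open>b\<close> because a challenged argument is evaluated on top of what is
  left of these stacks.\<close>

lemma run_pick:
  assumes "\<And>u p x b. (u, p) \<in> set ps \<Longrightarrow> run t g (Eval u) (map P p) e x b y z (f u p)"
    and "run t (g + 1) (Check v) (map P hs) e x (map Mark (map fst ps) @ b) y z w"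
  shows "run (t + 2 * length (concat (map piece ps)) + length hs + 2) (g + 1) Pick [] e
    (rev (HMark v # map P hs @ concat (map piece ps)) @ x) b y z ((\<forall>(u, p) \<in> set ps. f u p) \<and> w)"
  using assms
proof (induction ps arbitrary: b rule: rev_induct)
  case Nil
  have 1: "run (length hs + 1) (g + 1) Skip [] e (rev (map P hs) @ HMark v # x) b y z True"
    by (rule run_skip_head)
  have 2: "run (t + length hs + 1) (g + 1) Take [] e (rev (map P hs) @ HMark v # x) b y z w"
    by (rule run_take_head) (use Nil in simp)
  show ?case
    by (rule run_step2[where aL = "goto Skip" and aR = "goto Take" and tL = "length hs + 1"
          and tR = "t + length hs + 1" and gL = "g + 1" and gR = "g + 1"])
      (use 1 2 in auto)
next
  case (snoc up ps)
  obtain u p where up: "up = (u, p)" by (cases up)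
  let ?X = "rev (HMark v # map P hs @ concat (map piece ps)) @ x"
  let ?t = "t + 2 * length (concat (map piece ps)) + length hs + 2"
  have "run ?t (g + 1) Pick [] e ?X (Mark u # b) y z ((\<forall>(u, p) \<in> set ps. f u p) \<and> w)"
    by (rule snoc.IH) (use snoc.prems up in auto)
  then have 1: "run (?t + length p + 1) (g + 1) Skip [] e (rev (map P p) @ Mark u # ?X) b y z
      ((\<forall>(u, p) \<in> set ps. f u p) \<and> w)"
    by (rule run_skip_piece)
  have 2: "run (t + length p + 1) (g + 1) Take [] e (rev (map P p) @ Mark u # ?X) b y z (f u p)"
    by (rule run_take_piece) (use snoc.prems(1)[of u p] up in simp)
  have "run (?t + length p + 2) (g + 1) Pick [] e (rev (map P p) @ Mark u # ?X) b y z
      (((\<forall>(u, p) \<in> set ps. f u p) \<and> w) \<and> f u p)"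
    by (rule run_step2[where aL = "goto Skip" and aR = "goto Take" and tL = "?t + length p + 1"
          and tR = "t + length p + 1" and gL = "g + 1" and gR = "g + 1"
          and vL = "(\<forall>(u, p) \<in> set ps. f u p) \<and> w" and vR = "f u p"])
      (use 1 2 in auto)
  moreover have "(((\<forall>(u, p) \<in> set ps. f u p) \<and> w) \<and> f u p) = ((\<forall>(u, p) \<in> set (ps @ [up]). f u p) \<and> w)"
    by (auto simp: up)
  moreover have "rev (map P p) @ Mark u # ?X = rev (HMark v # map P hs @ concat (map piece (ps @ [up]))) @ x"
    by (simp add: up piece_def)
  ultimately have "run (?t + length p + 2) (g + 1) Pick [] e
    (rev (HMark v # map P hs @ concat (map piece (ps @ [up]))) @ x) b y z ((\<forall>(u, p) \<in> set (ps @ [up]). f u p) \<and> w)"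
    by (simp only:)
  then show ?case by (rule decides_mono) (auto simp: up piece_def)
qed

section \<open>Guessing the split into arguments\<close>

lemma run_step3:
  assumes "step q (peek s) (peek e) (peek x) (peek b) (peek y) (peek z) = {aL, aM, aR}"
    and "st_kind q = Exist" and "st_kind (fst aL) = Exist" "st_kind (fst aM) = Exist" "st_kind (fst aR) = Exist"
    and "run_acts t g aL s e x b y z vL" and "run_acts t g aM s e x b y z vM"
    and "run_acts t g aR s e x b y z vR" and "Suc t \<le> t'"
    and "v = (vL \<or> vM \<or> vR)"
  shows "run t' g q s e x b y z v"
  by (rule run_branch[where A = "{(aL, vL), (aM, vM), (aR, vR)}" and \<kappa> = Exist])
    (use assms in \<open>auto simp: quant_def\<close>)

fun annots :: "sym list \<Rightarrow> tsym list set" where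
  "annots [] = {[]}"
| "annots (a # s) = (\<lambda>l. P a # l) ` annots s \<union> (\<lambda>l. Mark True # P a # l) ` annots s
     \<union> (\<lambda>l. Mark False # P a # l) ` annots s"

text \<open>What precedes the first mark completes the head, and each mark opens an argument.
  Arguments are nonempty because a mark is always followed by a symbol.\<close>

lemma annots_pieces:
  "l \<in> annots s \<longleftrightarrow> (\<exists>hs ps. l = map P hs @ concat (map piece ps) \<and> s = hs @ concat (map snd ps)
     \<and> (\<forall>(u, p) \<in> set ps. p \<noteq> []))"
proof (induction s arbitrary: l)
  case Nil
  show ?case
  proof
    assume "\<exists>hs ps. l = map P hs @ concat (map piece ps) \<and> [] = hs @ concat (map snd ps)
     \<and> (\<forall>(u, p) \<in> set ps. p \<noteq> [])"
    then obtain hs ps where *: "l = map P hs @ concat (map piece ps)" "[] = hs @ concat (map snd ps)"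
      "\<forall>(u, p) \<in> set ps. p \<noteq> []" by blast
    then have "ps = []" by (cases ps) auto
    then show "l \<in> annots []" using * by simp
  qed (auto intro!: exI[of _ "[]"])
next
  case (Cons a s)
  show ?case
  proof
    assume "l \<in> annots (a # s)"
    then consider l' where "l' \<in> annots s" "l = P a # l'"
      | l' u where "l' \<in> annots s" "l = Mark u # P a # l'" by auto
    then show "\<exists>hs ps. l = map P hs @ concat (map piece ps) \<and> a # s = hs @ concat (map snd ps)
     \<and> (\<forall>(u, p) \<in> set ps. p \<noteq> [])"
    proof cases
      case 1
      then obtain hs ps where "l' = map P hs @ concat (map piece ps)" "s = hs @ concat (map snd ps)"
        "\<forall>(u, p) \<in> set ps. p \<noteq> []" using Cons.IH by blast
      with 1 show ?thesis by (intro exI[of _ "a # hs"] exI[of _ ps]) simp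
    next
      case 2
      then obtain hs ps where "l' = map P hs @ concat (map piece ps)" "s = hs @ concat (map snd ps)"
        "\<forall>(u, p) \<in> set ps. p \<noteq> []" using Cons.IH by blast
      with 2 show ?thesis by (intro exI[of _ "[]"] exI[of _ "(u, a # hs) # ps"]) (simp add: piece_def)
    qed
  next
    assume "\<exists>hs ps. l = map P hs @ concat (map piece ps) \<and> a # s = hs @ concat (map snd ps)
     \<and> (\<forall>(u, p) \<in> set ps. p \<noteq> [])"
    then obtain hs ps where *: "l = map P hs @ concat (map piece ps)" "a # s = hs @ concat (map snd ps)"
        "\<forall>(u, p) \<in> set ps. p \<noteq> []" by blast
    show "l \<in> annots (a # s)"
    proof (cases hs)
      case (Cons a' hs')
      then have "map P hs' @ concat (map piece ps) \<in> annots s" using * Cons.IH by auto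
      then show ?thesis using * Cons by auto
    next
      case Nil
      then obtain u p ps' where ps: "ps = (u, p) # ps'" using * by (cases ps) auto
      then obtain p' where p: "p = a # p'" using * Nil by (cases p) auto
      have "map P p' @ concat (map piece ps') \<in> annots s" using * Nil ps p Cons.IH by auto
      then show ?thesis using * Nil ps p by (cases u) (auto simp: piece_def)
    qed
  qed
qed

lemma run_guess:
  assumes "\<And>l. l \<in> annots s \<Longrightarrow> run t g Pick [] e (rev l @ x) b y z (f l)"
  shows "run (t + 2 * length s + 1) (g + 1) Guess (map P s) e x b y z (\<exists>l \<in> annots s. f l)"
  using assms
proof (induction s arbitrary: x f)
  case Nil
  show ?case
    by (rule run_step[where a = "goto Pick" and t = t and g = g]) (use Nil in auto)
next
  case (Cons a s)
  have A: "run (t + 2 * length s + 1) (g + 1) Guess (map P s) e (P a # x) b y z (\<exists>l \<in> annots s. f (P a # l))"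
    by (rule Cons.IH) (use Cons.prems in force)
  have B: "run (t + 2 * length s + 1) (g + 1) Guess (map P s) e (P a # Mark u # x) b y z
      (\<exists>l \<in> annots s. f (Mark u # P a # l))" for u
  proof (rule Cons.IH)
    fix l assume "l \<in> annots s"
    then have "Mark u # P a # l \<in> annots (a # s)" by (cases u) auto
    from Cons.prems[OF this] show "run t g Pick [] e (rev l @ P a # Mark u # x) b y z (f (Mark u # P a # l))" by simp
  qed
  have C: "run (t + 2 * length s + 2) (g + 1) Move (map P (a # s)) e (Mark u # x) b y z
      (\<exists>l \<in> annots s. f (Mark u # P a # l))" for u
    by (rule run_step[where a = "(Guess, Pop, Keep, Push (P a), Keep, Keep, Keep)"
          and t = "t + 2 * length s + 1" and g = "g + 1"]) (use B in auto)
  let ?t = "t + 2 * length s + 2"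
  show ?case
    by (rule run_step3[where aL = "(Guess, Pop, Keep, Push (P a), Keep, Keep, Keep)"
        and aM = "(Move, Keep, Keep, Push (Mark True), Keep, Keep, Keep)"
        and aR = "(Move, Keep, Keep, Push (Mark False), Keep, Keep, Keep)"
        and t = ?t and g = "g + 1"
        and vL = "\<exists>l \<in> annots s. f (P a # l)" and vM = "\<exists>l \<in> annots s. f (Mark True # P a # l)"
        and vR = "\<exists>l \<in> annots s. f (Mark False # P a # l)"])
      (use decides_mono[OF A, of ?t "g + 1"] C[of True] C[of False] in \<open>auto simp: bex_Un\<close>)
qed

section \<open>Guessing a table and extending the environment\<close>

definition tables :: "nat \<Rightarrow> tsym list set" where
  "tables m = {l. set l \<subseteq> {Mark True, Mark False, BEnd} \<and> length l \<le> m}"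

lemma tables_0: "tables 0 = {[]}"
  by (auto simp: tables_def)

text \<open>On a stack the symbol guessed first lies deepest, so the recursion peels off the last
  symbol of a table.\<close>

lemma tables_Suc: "tables (Suc m) = insert [] (\<Union>c \<in> {Mark True, Mark False, BEnd}. (\<lambda>l. l @ [c]) ` tables m)"
proof (intro set_eqI iffI)
  fix l assume "l \<in> tables (Suc m)"
  then show "l \<in> insert [] (\<Union>c \<in> {Mark True, Mark False, BEnd}. (\<lambda>l. l @ [c]) ` tables m)"
    by (cases l rule: rev_cases) (auto simp: tables_def)
qed (auto simp: tables_def)

text \<open>Each guessed symbol moves one unit of the yardstick to \<open>StZ\<close>, so exactly
  the words of length at most \<open>m\<close> arise. All guesses belong to one player; the extra
  switch is for entering \<open>Rewind\<close>.\<close>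

lemma run_table:
  assumes "\<And>l. l \<in> tables m \<Longrightarrow> run t g (Rewind v) s (l @ e) x b (replicate (m - length l) BEnd)
      (replicate (length l) BEnd @ z) (f l)"
  shows "run (t + m + 1) (g + 1) (Table v) s e x b (replicate m BEnd) z
    (quant (st_kind (Table v)) (tables m) f)"
  using assms
proof (induction m arbitrary: e z f)
  case 0
  show ?case
    by (rule run_step[where a = "goto (Rewind v)" and t = t and g = g])
      (use 0[of "[]"] alt_cost_le in \<open>auto simp: tables_0 quant_def\<close>)
next
  case (Suc m)
  let ?\<kappa> = "st_kind (Table v)"
  have A: "run t g (Rewind v) s e x b (replicate (Suc m) BEnd) z (f [])"
    using Suc.prems[of "[]"] by (simp add: tables_def)
  have B: "run (t + m + 1) (g + 1) (Table v) s (c # e) x b (replicate m BEnd) (BEnd # z)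
      (quant ?\<kappa> (tables m) (\<lambda>l. f (l @ [c])))" if "c \<in> {Mark True, Mark False, BEnd}" for c
  proof (rule Suc.IH)
    fix l assume "l \<in> tables m"
    then have "l @ [c] \<in> tables (Suc m)" using that by (auto simp: tables_def)
    from Suc.prems[OF this] show "run t g (Rewind v) s (l @ c # e) x b (replicate (m - length l) BEnd)
      (replicate (length l) BEnd @ BEnd # z) (f (l @ [c]))"
      by (simp add: replicate_app_Cons_same)
  qed
  let ?A = "insert (goto (Rewind v), f []) ((\<lambda>c. ((Table v, Keep, Push c, Keep, Keep, Pop, Push BEnd),
      quant ?\<kappa> (tables m) (\<lambda>l. f (l @ [c])))) ` {Mark True, Mark False, BEnd})"
  show ?case
  proof (rule run_branch[where A = ?A and \<kappa> = ?\<kappa>])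
    show "quant ?\<kappa> (tables (Suc m)) f = quant ?\<kappa> ?A snd"
      unfolding tables_Suc by (simp add: quant_def ball_Un bex_Un)
    have 1: "\<exists>t' g'. run_acts t' g' (goto (Rewind v)) s e x b (replicate (Suc m) BEnd) z (f []) \<and>
        g' + alt_cost ?\<kappa> (st_kind (Rewind v)) \<le> g + 1 \<and> Suc t' \<le> t + Suc m + 1"
      by (rule exI[of _ t], rule exI[of _ g]) (use A alt_cost_le in auto)
    have 2: "\<exists>t' g'. run_acts t' g' (Table v, Keep, Push c, Keep, Keep, Pop, Push BEnd) s e x b (replicate (Suc m) BEnd) z
        (quant ?\<kappa> (tables m) (\<lambda>l. f (l @ [c]))) \<and>
        g' + alt_cost ?\<kappa> (st_kind (Table v)) \<le> g + 1 \<and> Suc t' \<le> t + Suc m + 1"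
      if "c \<in> {Mark True, Mark False, BEnd}" for c
      by (rule exI[of _ "t + m + 1"], rule exI[of _ "g + 1"]) (use B[OF that] in auto)
    show "\<forall>(a, v) \<in> ?A. \<exists>t' g'. run_acts t' g' a s e x b (replicate (Suc m) BEnd) z v \<and>
        g' + alt_cost ?\<kappa> (st_kind (fst a)) \<le> g + 1 \<and> Suc t' \<le> t + Suc m + 1"
      using 1 2 by (simp only: ball_simps image_iff prod.case fst_conv) blast
  qed auto
qed

lemma run_rewind:
  assumes "run t g (PutHdr v) s (HEnd # e) x b (replicate (j + m) BEnd) [] w"
  shows "run (t + j + 1) g (Rewind v) s e x b (replicate m BEnd) (replicate j BEnd) w"
  using assms
proof (induction j arbitrary: m)
  case 0
  show ?case
    by (rule run_step[where a = "(PutHdr v, Keep, Push HEnd, Keep, Keep, Keep, Keep)" and t = t and g = g])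
      (use 0 in auto)
next
  case (Suc j)
  have "run (t + j + 1) g (Rewind v) s e x b (replicate (Suc m) BEnd) (replicate j BEnd) w"
    by (rule Suc.IH) (use Suc.prems in simp)
  then show ?case
    by - (rule run_step[where a = "(Rewind v, Keep, Keep, Keep, Keep, Push BEnd, Pop)"
        and t = "t + j + 1" and g = g], auto)
qed

lemma run_put_header:
  assumes "run t g (Eval v) s (map P k @ e) (HMark u # x) b y z w"
  shows "run (t + length k + 1) g (PutHdr v) s e (rev (map P k) @ HMark u # x) b y z w"
  using assms
proof (induction k arbitrary: e rule: rev_induct)
  case Nil
  show ?case
    by (rule run_step[where a = "goto (Eval v)" and t = t and g = g]) (use Nil in auto)
next
  case (snoc a k)
  have "run (t + length k + 1) g (PutHdr v) s (P a # e) (rev (map P k) @ HMark u # x) b y z w"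
    by (rule snoc.IH) (use snoc.prems in simp)
  then show ?case
    by - (rule run_step[where a = "(PutHdr v, Keep, Push (P a), Pop, Keep, Keep, Keep)"
        and t = "t + length k + 1" and g = g], auto)
qed

text \<open>Functional form of the parse by \<open>Hdr\<close>: it splits off two numerals, each
  with its \<open>SHash\<close>, and refuses a numeral ending in \<open>SB0\<close>, that is, with a
  zero as most significant digit.\<close>

fun header :: "bool \<Rightarrow> bool \<Rightarrow> sym list \<Rightarrow> (sym list \<times> sym list) option" where
  "header c l (SB0 # s) = map_option (apfst (Cons SB0)) (header c True s)"
| "header c l (SB1 # s) = map_option (apfst (Cons SB1)) (header c False s)"
| "header c l (SHash # s) = (if l then None else if c then Some ([SHash], s)
     else map_option (apfst (Cons SHash)) (header True False s))"
| "header c l _ = None"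

lemma run_header_None:
  "header c l s = None \<Longrightarrow> run (length s + 1) g (Hdr c l v) (map P s) e x b y z False"
proof (induction c l s arbitrary: x rule: header.induct)
  case (1 c l s)
  then show ?case
    by - (rule run_step[where a = "(Hdr c True v, Pop, Keep, Push (P SB0), Keep, Keep, Keep)"
        and t = "length s + 1" and g = g], auto)
next
  case (2 c l s)
  then show ?case
    by - (rule run_step[where a = "(Hdr c False v, Pop, Keep, Push (P SB1), Keep, Keep, Keep)"
        and t = "length s + 1" and g = g], auto)
next
  case (3 c l s)
  show ?case
  proof (cases l)
    case True
    show ?thesis by (rule run_reject) (auto simp: True)
  next
    case False
    with 3 show ?thesis
      by - (rule run_step[where a = "(Hdr True False v, Pop, Keep, Push (P SHash), Keep, Keep, Keep)"
        and t = "length s + 1" and g = g], auto split: if_splits)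
  qed
qed (rule run_reject, auto)+

lemma run_header_Some:
  assumes "header c l s = Some (k, r)"
    and "run t g (Table v) (map P r) (SecEnd # e) (rev (map P k) @ x) b y z w"
  shows "run (t + length s + 1) (g + 1) (Hdr c l v) (map P s) e x b y z w"
  using assms
proof (induction c l s arbitrary: x k rule: header.induct)
  case (1 c l s)
  then obtain k' where k: "k = SB0 # k'" "header c True s = Some (k', r)" by auto
  then have "run (t + length s + 1) (g + 1) (Hdr c True v) (map P s) e (P SB0 # x) b y z w"
    using 1 by simp
  then show ?case
    by - (rule run_step[where a = "(Hdr c True v, Pop, Keep, Push (P SB0), Keep, Keep, Keep)"
        and t = "t + length s + 1" and g = "g + 1"], auto)
next
  case (2 c l s)
  then obtain k' where k: "k = SB1 # k'" "header c False s = Some (k', r)" by auto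
  then have "run (t + length s + 1) (g + 1) (Hdr c False v) (map P s) e (P SB1 # x) b y z w"
    using 2 by simp
  then show ?case
    by - (rule run_step[where a = "(Hdr c False v, Pop, Keep, Push (P SB1), Keep, Keep, Keep)"
        and t = "t + length s + 1" and g = "g + 1"], auto)
next
  case (3 c l s)
  show ?case
  proof (cases c)
    case True
    then have "\<not> l" "k = [SHash]" "r = s" using 3(2) by (auto split: if_splits)
    then show ?thesis using True 3(3) alt_cost_le
      by - (rule run_step[where a = "(Table v, Pop, Push SecEnd, Push (P SHash), Keep, Keep, Keep)"
        and t = t and g = g], auto)
  next
    case False
    then obtain k' where k: "\<not> l" "k = SHash # k'" "header True False s = Some (k', r)"
      using 3(2) by (auto split: if_splits)
    then have "run (t + length s + 1) (g + 1) (Hdr True False v) (map P s) e (P SHash # x) b y z w"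
      using 3 False by simp
    then show ?thesis using k False
      by - (rule run_step[where a = "(Hdr True False v, Pop, Keep, Push (P SHash), Keep, Keep, Keep)"
        and t = "t + length s + 1" and g = "g + 1"], auto)
  qed
qed auto

section \<open>Producing the yardstick\<close>

lemma run_dup:
  assumes "run t g BBack s e x b [] (replicate (2 * m + j) BEnd) w"
  shows "run (t + 2 * m + 1) g BDup s e x b (replicate m BEnd) (replicate j BEnd) w"
  using assms
proof (induction m arbitrary: j)
  case 0
  show ?case
    by (rule run_step[where a = "goto BBack" and t = t and g = g]) (use 0 in auto)
next
  case (Suc m)
  have "run (t + 2 * m + 1) g BDup s e x b (replicate m BEnd) (replicate (Suc (Suc j)) BEnd) w"
    by (rule Suc.IH) (use Suc.prems in simp)
  then have "run (t + 2 * m + 2) g BDup2 s e x b (replicate m BEnd) (replicate (Suc j) BEnd) w"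
    by - (rule run_step[where a = "(BDup, Keep, Keep, Keep, Keep, Keep, Push BEnd)"
        and t = "t + 2 * m + 1" and g = g], auto)
  then show ?case
    by - (rule run_step[where a = "(BDup2, Keep, Keep, Keep, Keep, Pop, Push BEnd)"
        and t = "t + 2 * m + 2" and g = g], auto)
qed

lemma run_back:
  assumes "run t g BLoop s e x b (replicate (m + j) BEnd) [] w"
  shows "run (t + j + 1) g BBack s e x b (replicate m BEnd) (replicate j BEnd) w"
  using assms
proof (induction j arbitrary: m)
  case 0
  show ?case
    by (rule run_step[where a = "goto BLoop" and t = t and g = g]) (use 0 in auto)
next
  case (Suc j)
  have "run (t + j + 1) g BBack s e x b (replicate (Suc m) BEnd) (replicate j BEnd) w"
    by (rule Suc.IH) (use Suc.prems in simp)
  then show ?case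
    by - (rule run_step[where a = "(BBack, Keep, Keep, Keep, Keep, Push BEnd, Pop)"
        and t = "t + j + 1" and g = g], auto)
qed

lemma run_restore:
  assumes "run t g (Eval True) (rev x @ s) e [] b y z w"
  shows "run (t + length x + 1) g BRest s e x b y z w"
  using assms
proof (induction x arbitrary: s)
  case Nil
  show ?case
    by (rule run_step[where a = "goto (Eval True)" and t = t and g = g]) (use Nil in auto)
next
  case (Cons a x)
  have "run (t + length x + 1) g BRest (a # s) e x b y z w"
    by (rule Cons.IH) (use Cons.prems in simp)
  then show ?case
    by - (rule run_step[where a = "(BRest, Push a, Keep, Pop, Keep, Keep, Keep)"
        and t = "t + length x + 1" and g = g], auto)
qed

text \<open>Doubling costs \<open>4 * m + 3\<close> steps per input symbol, and one more step
  restores the symbol. The doubling costs form a geometric sum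
  \<open>4 * m * (2 ^ length s - 1)\<close>; its negative part stands next to \<open>t'\<close> to
  avoid subtraction.\<close>

lemma run_boot_loop:
  assumes "run t g (Eval True) (rev x @ s) e [] b (replicate (m * 2 ^ length s) BEnd) [] w"
    and "t + 4 * m * 2 ^ length s + 4 * length s + length x + 2 \<le> t' + 4 * m"
  shows "run t' g BLoop s e x b (replicate m BEnd) [] w"
  using assms
proof (induction s arbitrary: x m t')
  case Nil
  have "run (t + length x + 1) g BRest [] e x b (replicate m BEnd) [] w"
    by (rule run_restore) (use Nil in simp)
  then show ?case using Nil.prems(2)
    by - (rule run_step[where a = "goto BRest" and t = "t + length x + 1" and g = g], auto)
next
  case (Cons a s)
  let ?t = "t' - 4 * m - 3"
  define n where "n = m * 2 ^ length s"
  have "m \<le> n" by (simp add: n_def)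
  moreover have "t + 8 * n + 4 * (length s + 1) + length x + 2 \<le> t' + 4 * m"
    using Cons.prems(2) by (simp add: n_def algebra_simps)
  ultimately have t': "4 * m + 3 \<le> t'" by (simp add: algebra_simps)
  have "run ?t g BLoop s e (a # x) b (replicate (2 * m) BEnd) [] w"
    by (rule Cons.IH) (use Cons.prems t' in \<open>simp_all add: ac_simps\<close>)
  then have "run (?t + 2 * m + 1) g BBack s e (a # x) b [] (replicate (2 * m) BEnd) w"
    using run_back[of ?t g s e "a # x" b 0 "2 * m" w] by simp
  then have "run (?t + 2 * m + 1 + 2 * m + 1) g BDup s e (a # x) b (replicate m BEnd) [] w"
    using run_dup[of "?t + 2 * m + 1" g s e "a # x" b m 0 w] by simp
  then show ?case using t'
    by - (rule run_step[where a = "(BDup, Pop, Keep, Push a, Keep, Keep, Keep)"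
        and t = "?t + 2 * m + 1 + 2 * m + 1" and g = g], auto)
qed

section \<open>Encodings and semantics\<close>

lemma set_bin: "set (bin k) \<subseteq> {SB0, SB1}"
proof (induction k rule: bin.induct)
  case (1 k)
  then show ?case by (subst bin.simps) auto
qed

lemma hash_notin_bin: "SHash \<notin> set (bin k)"
  using set_bin[of k] by auto

fun unbin :: "sym list \<Rightarrow> nat" where
  "unbin [] = 0"
| "unbin (a # s) = of_bool (a = SB1) + 2 * unbin s"

lemma unbin_bin: "unbin (bin k) = k"
proof (induction k rule: bin.induct)
  case (1 k)
  show ?case
  proof (cases "k = 0")
    case False
    have "unbin (bin k) = of_bool (odd k) + 2 * (k div 2)"
      using 1 False by (subst bin.simps) auto
    then show ?thesis by (metis add.commute mod_mult_div_eq mod_2_eq_odd mult.commute odd_of_bool_self)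
  qed (simp add: bin.simps)
qed

lemma bin_inj: "bin i = bin j \<longleftrightarrow> i = j"
  by (metis unbin_bin)

lemma less_two_power_bin: "n < 2 ^ length (bin n)"
proof (induction n rule: bin.induct)
  case (1 k)
  show ?case
  proof (cases "k = 0")
    case False
    then have "k div 2 < 2 ^ length (bin (k div 2))" using 1 by blast
    then show ?thesis using False by (subst bin.simps) auto
  qed (simp add: bin.simps)
qed

lemma append_hash_inj:
  assumes "SHash \<notin> set u" "SHash \<notin> set v"
  shows "u @ SHash # x = v @ SHash # y \<longleftrightarrow> u = v \<and> x = y"
  using assms
proof (induction u arbitrary: v)
  case Nil
  then show ?case by (cases v) auto
next
  case (Cons a u)
  then show ?case by (cases v) auto
qed

lemma bin_hash_inj: "bin i @ SHash # x = bin j @ SHash # y \<longleftrightarrow> i = j \<and> x = y"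
  by (simp add: append_hash_inj hash_notin_bin bin_inj)

text \<open>Literally the part of \<open>enc\<close> behind \<open>SApp\<close> or
  \<open>SEx\<close> that names the variable, so an occurrence is matched with its quantifier by
  comparing raw input.\<close>

definition key :: "nat \<Rightarrow> nat \<Rightarrow> sym list" where
  "key i n = bin i @ SHash # bin n @ [SHash]"

lemma key_inj: "key i n = key j m \<longleftrightarrow> i = j \<and> n = m"
  by (simp add: key_def bin_hash_inj bin_inj)

lemma key_append_inj: "key i n @ x = key j m @ y \<longleftrightarrow> i = j \<and> n = m \<and> x = y"
  by (simp add: key_def bin_hash_inj)

lemma digits_ok_bin: "digits_ok (bin n @ SHash # r) m \<longleftrightarrow> m = n"
proof (induction n arbitrary: m rule: bin.induct)
  case (1 n)
  show ?case
  proof (cases "n = 0")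
    case False
    then have IH: "digits_ok (bin (n div 2) @ SHash # r) (m div 2) \<longleftrightarrow> m div 2 = n div 2" using 1 by blast
    have "m = n \<longleftrightarrow> even m = even n \<and> m div 2 = n div 2"
      by (metis even_iff_mod_2_eq_zero mult_div_mod_eq odd_iff_mod_2_eq_one)
    then show ?thesis using False IH by (subst bin.simps) auto
  qed (simp add: bin.simps)
qed

lemma arity_ok_key: "arity_ok (key i n) m \<longleftrightarrow> m = n"
proof -
  have "set l \<subseteq> {SB0, SB1} \<Longrightarrow> arity_ok (l @ SHash # bin n @ [SHash]) m \<longleftrightarrow> m = n" for l
    by (induction l) (auto simp: digits_ok_bin)
  from this[OF set_bin] show ?thesis by (simp add: key_def)
qed

lemma bin_eq_Nil: "bin n = [] \<longleftrightarrow> n = 0"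
  by (subst bin.simps) auto

lemma last_bin: "n \<noteq> 0 \<Longrightarrow> last (bin n) = SB1"
proof (induction n rule: bin.induct)
  case (1 n)
  show ?case
  proof (cases "n div 2 = 0")
    case True
    then have "n = 1" using 1 by auto
    then show ?thesis by (simp add: bin.simps)
  next
    case False
    then show ?thesis using 1 by (subst bin.simps) (auto simp: bin_eq_Nil)
  qed
qed

lemma canonical_bin:
  "set u \<subseteq> {SB0, SB1} \<Longrightarrow> u = [] \<or> last u = SB1 \<Longrightarrow> \<exists>k. u = bin k"
proof (induction u)
  case Nil
  then show ?case by (metis bin_eq_Nil)
next
  case (Cons a u)
  then obtain k where k: "u = bin k" by (cases u) auto
  show ?case
  proof (cases "a = SB1")
    case True
    then have "a # u = bin (2 * k + 1)" by (subst bin.simps) (simp add: k)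
    then show ?thesis by blast
  next
    case False
    then have "a = SB0" "k \<noteq> 0" using Cons.prems k by (auto simp: bin_eq_Nil split: if_splits)
    then have "a # u = bin (2 * k)" by (subst bin.simps) (simp add: k)
    then show ?thesis by blast
  qed
qed

lemma header_digits:
  assumes "set u \<subseteq> {SB0, SB1}"
  shows "header c l (u @ s) = map_option (apfst ((@) u)) (header c (if u = [] then l else last u = SB0) s)"
  using assms
proof (induction u arbitrary: l)
  case Nil
  show ?case by (cases "header c l s") auto
next
  case (Cons a u)
  then show ?case
    by (cases "header c (if u = [] then a = SB0 else last u = SB0) s") (auto split: if_splits)
qed

lemma header_key: "header False False (key i n @ r) = Some (key i n, r)"
proof -
  have *: "(if bin k = [] then False else last (bin k) = SB0) = False" for k
    using last_bin[of k] by (auto simp: bin_eq_Nil)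
  show ?thesis
    by (simp only: key_def append.assoc append_Cons header_digits[OF set_bin] * header.simps if_False)
      simp
qed

lemma header_SomeE:
  assumes "header False False s = Some (k, r)"
  obtains i n where "k = key i n" "s = key i n @ r"
proof -
  \<comment> \<open>\<open>Q c u k s\<close> says what comes after the digits \<open>u\<close>: with
    \<open>c\<close> the key ends at the next \<open>SHash\<close>, otherwise a second numeral
    follows it.\<close>
  define Q where "Q c u k s \<longleftrightarrow> (if c then k = u @ [SHash] \<and> s = u @ SHash # r
       else \<exists>k' s'. header True False s' = Some (k', r) \<and> k = u @ SHash # k' \<and> s = u @ SHash # s')"
    for c u k s
  have Q: "Q c (a # u) (a # k) (a # s)" if "Q c u k s" for c a u k s
    using that by (auto simp: Q_def split: if_splits)
  have split: "\<exists>u. set u \<subseteq> {SB0, SB1} \<and> (if u = [] then \<not> l else last u = SB1) \<and> Q c u k s"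
    if "header c l s = Some (k, r)" for c l s k
    using that
  proof (induction c l s arbitrary: k rule: header.induct)
    case (1 c l s)
    then obtain k' where k': "k = SB0 # k'" "header c True s = Some (k', r)" by auto
    from 1(1)[OF k'(2)] obtain u where "set u \<subseteq> {SB0, SB1}" "u \<noteq> []" "last u = SB1" "Q c u k' s"
      by (metis (full_types))
    then show ?case by (intro exI[of _ "SB0 # u"]) (simp add: k' Q)
  next
    case (2 c l s)
    then obtain k' where k': "k = SB1 # k'" "header c False s = Some (k', r)" by auto
    from 2(1)[OF k'(2)] obtain u where "set u \<subseteq> {SB0, SB1}" "u = [] \<or> last u = SB1" "Q c u k' s"
      by metis
    then show ?case by (intro exI[of _ "SB1 # u"]) (auto simp: k' Q)
  next
    case (3 c l s)
    then show ?case by (intro exI[of _ "[]"]) (auto simp: Q_def split: if_splits)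
  qed auto
  from split[OF assms] obtain u k' s' where u: "set u \<subseteq> {SB0, SB1}" "u = [] \<or> last u = SB1"
    "header True False s' = Some (k', r)" "k = u @ SHash # k'" "s = u @ SHash # s'" unfolding Q_def by (metis (full_types))
  from split[OF u(3)] obtain v where v: "set v \<subseteq> {SB0, SB1}" "v = [] \<or> last v = SB1"
    "k' = v @ [SHash]" "s' = v @ SHash # r" unfolding Q_def by (metis (full_types))
  from canonical_bin[OF u(1,2)] canonical_bin[OF v(1,2)] obtain i n where "u = bin i" "v = bin n" by blast
  then show ?thesis using that[of i n] u v by (simp add: key_def)
qed

section \<open>Unique readability and dependence on free variables\<close>

lemma enc_nonempty: "enc \<phi> \<noteq> []"
  by (cases \<phi>) auto

lemma enc_App: "enc (App i n args) = SApp # key i n @ concat (map enc args)"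
  and enc_Ex: "enc (Ex i n a) = SEx # key i n @ enc a"
  by (simp_all add: key_def)

lemma enc_list_prefix_free:
  assumes "\<And>a b r r'. a \<in> set as \<Longrightarrow> wf_qbsf b \<Longrightarrow> enc a @ r = enc b @ r' \<Longrightarrow> a = b \<and> r = r'"
    and "length as = length bs" "\<forall>b \<in> set bs. wf_qbsf b"
    and "concat (map enc as) @ r = concat (map enc bs) @ r'"
  shows "as = bs \<and> r = r'"
  using assms(2,1,3,4)
proof (induction as bs rule: list_induct2)
  case (Cons a as b bs)
  from Cons.prems(1)[of a b "concat (map enc as) @ r" "concat (map enc bs) @ r'"] Cons.prems
  have "a = b" "concat (map enc as) @ r = concat (map enc bs) @ r'" by auto
  with Cons.IH Cons.prems show ?case by auto
qed simp

text \<open>Prefix notation is uniquely readable once the number of arguments is known, and for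
  well-formed formulas that number is the arity contained in the key.\<close>

lemma enc_prefix_free:
  "wf_qbsf \<phi> \<Longrightarrow> wf_qbsf \<psi> \<Longrightarrow> enc \<phi> @ r = enc \<psi> @ r' \<Longrightarrow> \<phi> = \<psi> \<and> r = r'"
proof (induction \<phi> arbitrary: \<psi> r r')
  case FF
  then show ?case by (cases \<psi>) auto
next
  case TT
  then show ?case by (cases \<psi>) auto
next
  case (App i n as)
  from App.prems(3) obtain j m bs where \<psi>: "\<psi> = App j m bs" by (cases \<psi>) auto
  have eq: "i = j" "n = m" "concat (map enc as) @ r = concat (map enc bs) @ r'"
    using App.prems(3) unfolding \<psi> enc_App by (auto simp: key_append_inj)
  have "as = bs \<and> r = r'"
  proof (rule enc_list_prefix_free[OF _ _ _ eq(3)])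
    fix a b r r' assume a: "a \<in> set as" and b: "wf_qbsf b" "enc a @ r = enc b @ r'"
    have "wf_qbsf a" using App.prems(1) a by simp
    from App.IH[OF a this b] show "a = b \<and> r = r'" .
  qed (use App.prems(1,2) eq \<psi> in simp_all)
  then show ?case using eq \<psi> by simp
next
  case (Conj a b)
  from Conj.prems(3) obtain a' b' where \<psi>: "\<psi> = Conj a' b'" by (cases \<psi>) auto
  have "a = a' \<and> enc b @ r = enc b' @ r'" by (rule Conj.IH(1)) (use Conj.prems \<psi> in simp_all)
  moreover from this have "b = b' \<and> r = r'" by (intro Conj.IH(2)) (use Conj.prems \<psi> in simp_all)
  ultimately show ?case using \<psi> by simp
next
  case (Neg a)
  from Neg.prems(3) obtain a' where \<psi>: "\<psi> = Neg a'" by (cases \<psi>) auto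
  have "a = a' \<and> r = r'" by (rule Neg.IH) (use Neg.prems \<psi> in simp_all)
  then show ?case using \<psi> by simp
next
  case (Ex i n a)
  from Ex.prems(3) obtain j m a' where \<psi>: "\<psi> = Ex j m a'" by (cases \<psi>) auto
  have eq: "i = j" "n = m" "enc a @ r = enc a' @ r'"
    using Ex.prems(3) unfolding \<psi> enc_Ex by (auto simp: key_append_inj)
  have "a = a' \<and> r = r'" by (rule Ex.IH[OF _ _ eq(3)]) (use Ex.prems(1,2) \<psi> in simp_all)
  then show ?case using eq \<psi> by simp
qed

text \<open>In a well-formed formula a function is only applied to vectors of its arity. This is why
  a finite table can replace a function on all lists.\<close>

lemma eval_cong:
  assumes "wf_qbsf \<phi>" "\<And>i n bs. (i, n) \<in> fv \<phi> \<Longrightarrow> length bs = n \<Longrightarrow> I i n bs = J i n bs"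
  shows "eval I \<phi> = eval J \<phi>"
  using assms
proof (induction \<phi> arbitrary: I J)
  case (App i n as)
  have "eval I a = eval J a" if "a \<in> set as" for a
    by (rule App.IH[OF that]) (use App.prems that in auto)
  then have "map (eval I) as = map (eval J) as" by simp
  moreover have "I i n (map (eval J) as) = J i n (map (eval J) as)"
    by (rule App.prems) (use App.prems in auto)
  ultimately show ?case by (simp only: eval.simps)
next
  case (Conj a b)
  have "eval I a = eval J a" by (rule Conj.IH(1)) (use Conj.prems in auto)
  moreover have "eval I b = eval J b" by (rule Conj.IH(2)) (use Conj.prems in auto)
  ultimately show ?case by simp
next
  case (Neg a)
  have "eval I a = eval J a" by (rule Neg.IH) (use Neg.prems in auto)
  then show ?case by simp
next
  case (Ex i n a)
  have "eval (I(i := (I i)(n := F))) a = eval (J(i := (J i)(n := F))) a" for F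
    by (rule Ex.IH) (use Ex.prems in auto)
  then show ?case by simp
qed simp_all

text \<open>A free variable of arity \<open>n\<close> occurs somewhere with \<open>n\<close>
  arguments of nonempty code, and the digits of \<open>n\<close> stand beside them.\<close>

lemma arity_bound:
  "wf_qbsf \<phi> \<Longrightarrow> (i, n) \<in> fv \<phi> \<Longrightarrow> n + length (bin n) \<le> length (enc \<phi>)"
proof (induction \<phi>)
  case (App j m as)
  have as: "length as \<le> length (concat (map enc as))" for as
  proof (induction as)
    case (Cons a as)
    then show ?case using enc_nonempty[of a] by (cases "enc a") auto
  qed simp
  show ?case
  proof (cases "(i, n) = (j, m)")
    case True
    then show ?thesis using App.prems as[of as] by simp
  next
    case False
    then obtain a where a: "a \<in> set as" "(i, n) \<in> fv a" using App.prems by auto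
    then have "n + length (bin n) \<le> length (enc a)" using App by auto
    also have "\<dots> \<le> length (concat (map enc as))"
      using a(1) by (induction as) auto
    finally show ?thesis by simp
  qed
qed auto

section \<open>Tables as functions and the claims of the game\<close>

lemma memb_table: "memb bs (concat (map (\<lambda>c. BEnd # map Mark c) L)) \<longleftrightarrow> bs \<in> set L"
proof (induction L)
  case (Cons c L)
  let ?r = "concat (map (\<lambda>c. BEnd # map Mark c) L)"
  have 1: "takeWhile data (map Mark c @ ?r) = map Mark c"
  proof -
    have "takeWhile data ?r = []" by (cases L) auto
    then show ?thesis by (induction c) auto
  qed
  have 2: "memb bs (map Mark c @ l) = memb bs l" for l by (induction c) auto
  have "inj Mark" by (simp add: inj_def)
  then show ?case using Cons 1 2 by (auto simp: inj_map_eq_map)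
qed simp

text \<open>One block of \<open>n + 1\<close> symbols for each vector that \<open>F\<close> maps to
  true, of which there are at most \<open>2 ^ n\<close>.\<close>

lemma table_exists:
  assumes "2 ^ n * (n + 1) \<le> m"
  shows "\<exists>l \<in> tables m. \<forall>bs. length bs = n \<longrightarrow> memb bs l = F bs"
proof -
  let ?A = "{bs :: bool list. set bs \<subseteq> UNIV \<and> length bs = n}"
  have A: "finite ?A" "card ?A = 2 ^ n"
    using finite_lists_length_eq[of "UNIV :: bool set" n] card_lists_length_eq[of "UNIV :: bool set" n] by auto
  let ?B = "{bs \<in> ?A. F bs}"
  have B: "finite ?B" "card ?B \<le> 2 ^ n" using A card_mono[of ?A ?B] by auto
  obtain L where L: "set L = ?B" "distinct L" using finite_distinct_list[OF B(1)] by blast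
  let ?l = "concat (map (\<lambda>c. BEnd # map Mark c) L)"
  have len: "length L \<le> 2 ^ n" using L B distinct_card by metis
  have "\<forall>c \<in> set L. length c = n" using L by auto
  then have "length ?l = length L * (n + 1)" by (induction L) auto
  also have "\<dots> \<le> m" using mult_le_mono1[OF len] assms by (rule order_trans)
  finally have "?l \<in> tables m" by (auto simp: tables_def)
  moreover have "\<forall>bs. length bs = n \<longrightarrow> memb bs ?l = F bs" using L(1) by (auto simp: memb_table)
  ultimately show ?thesis by blast
qed

definition env_int :: "env \<Rightarrow> interp" where
  "env_int \<rho> i n bs = look (key i n) bs True \<rho>"

definition bound_in :: "env \<Rightarrow> (nat \<times> nat) set \<Rightarrow> bool" where
  "bound_in \<rho> A \<longleftrightarrow> (\<forall>(i, n) \<in> A. key i n \<in> fst ` set \<rho>)"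

text \<open>The two values of \<open>v\<close> are not complementary: a string that is no formula,
  or has an unbound variable, falsifies both claims.\<close>

definition holds :: "bool \<Rightarrow> sym list \<Rightarrow> env \<Rightarrow> bool" where
  "holds v s \<rho> \<longleftrightarrow> (\<exists>\<phi>. enc \<phi> = s \<and> wf_qbsf \<phi> \<and> bound_in \<rho> (fv \<phi>) \<and> eval (env_int \<rho>) \<phi> = v)"

lemma look_iff: "look k bs v \<rho> \<longleftrightarrow> k \<in> fst ` set \<rho> \<and> look k bs True \<rho> = v"
proof (induction \<rho>)
  case (Cons kl \<rho>)
  obtain k' l where "kl = (k', l)" by (cases kl)
  then show ?case using Cons by (cases "k = k'") auto
qed simp

lemma env_int_Cons:
  "env_int ((key i n, l) # \<rho>) = (env_int \<rho>)(i := (env_int \<rho> i)(n := \<lambda>bs. memb bs l))"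
  by (auto simp: env_int_def key_inj fun_eq_iff)

lemma bound_in_Cons: "bound_in ((key i n, l) # \<rho>) A \<longleftrightarrow> bound_in \<rho> (A - {(i, n)})"
  by (auto simp: bound_in_def key_inj)

lemma bound_in_simps:
  "bound_in \<rho> (A \<union> B) \<longleftrightarrow> bound_in \<rho> A \<and> bound_in \<rho> B" "bound_in \<rho> {}"
  "bound_in \<rho> (insert (i, n) A) \<longleftrightarrow> key i n \<in> fst ` set \<rho> \<and> bound_in \<rho> A"
  "bound_in \<rho> (\<Union>(f ` C)) \<longleftrightarrow> (\<forall>c \<in> C. bound_in \<rho> (f c))"
  by (auto simp: bound_in_def ball_Un)

text \<open>Functions can be replaced by tables because only arities of variables occurring in the
  body matter, and quantifiers over tables pass across the choice of the body because its code
  determines it.\<close>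

lemma holds_Ex:
  assumes m: "2 ^ length s \<le> m"
  shows "holds v (SEx # s) \<rho> \<longleftrightarrow> (case header False False s of None \<Rightarrow> False
    | Some (k, r) \<Rightarrow> quant (if v then Exist else Univ) (tables m) (\<lambda>l. holds v r ((k, l) # \<rho>)))"
proof (cases "header False False s")
  case None
  have False if "enc \<phi> = SEx # s" for \<phi>
  proof -
    from that obtain i n a where "\<phi> = Ex i n a" by (cases \<phi>) auto
    then have "s = key i n @ enc a" using that by (simp add: key_def)
    then show False using None header_key by simp
  qed
  then show ?thesis using None by (auto simp: holds_def)
next
  case (Some kr)
  obtain k r where kr: "kr = (k, r)" by (cases kr)
  then obtain i n where k: "k = key i n" and s: "s = key i n @ r" using Some header_SomeE by metis
  have enc: "enc \<phi> = SEx # s \<longleftrightarrow> (\<exists>a. \<phi> = Ex i n a \<and> enc a = r)" for \<phi>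
    by (cases \<phi>) (auto simp: s enc_Ex key_append_inj simp del: enc.simps(3,6), auto simp: key_def)
  have table: "\<exists>l \<in> tables m. eval (env_int ((k, l) # \<rho>)) a
      = eval ((env_int \<rho>)(i := (env_int \<rho> i)(n := F))) a" if a: "enc a = r" "wf_qbsf a" for a F
  proof (cases "(i, n) \<in> fv a")
    case True
    \<comment> \<open>The factor \<open>n + 1\<close> is absorbed by the digits of \<open>n\<close>,
      which is why \<open>arity_bound\<close> counts them too.\<close>
    have "2 ^ n * (n + 1) \<le> 2 ^ n * (2 ^ length (bin n) :: nat)"
      using less_two_power_bin[of n] by (intro mult_le_mono2) simp
    also have "\<dots> = 2 ^ (n + length (bin n))" by (simp add: power_add)
    also have "\<dots> \<le> 2 ^ length s"
      using arity_bound[OF a(2) True] a(1) by (intro power_increasing) (auto simp: s)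
    also have "\<dots> \<le> m" by (rule m)
    finally obtain l where l: "l \<in> tables m" "\<forall>bs. length bs = n \<longrightarrow> memb bs l = F bs"
      using table_exists by blast
    have "eval (env_int ((k, l) # \<rho>)) a = eval ((env_int \<rho>)(i := (env_int \<rho> i)(n := F))) a"
      by (rule eval_cong[OF a(2)]) (use l in \<open>auto simp: k env_int_Cons\<close>)
    then show ?thesis using l(1) by blast
  next
    case False
    \<comment> \<open>A variable absent from the body may have any table; the empty one is always
      available.\<close>
    have "eval (env_int ((k, []) # \<rho>)) a = eval ((env_int \<rho>)(i := (env_int \<rho> i)(n := F))) a"
      by (rule eval_cong[OF a(2)]) (use False in \<open>auto simp: k env_int_Cons\<close>)
    moreover have "[] \<in> tables m" by (simp add: tables_def)
    ultimately show ?thesis by blast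
  qed
  have ex: "(\<exists>F. eval ((env_int \<rho>)(i := (env_int \<rho> i)(n := F))) a) \<longleftrightarrow>
      (\<exists>l \<in> tables m. eval (env_int ((k, l) # \<rho>)) a)" if "enc a = r" "wf_qbsf a" for a
    using table[OF that] unfolding k env_int_Cons by metis
  have bound: "bound_in ((k, l) # \<rho>) (fv a) \<longleftrightarrow> bound_in \<rho> (fv a - {(i, n)})" for l a
    by (simp add: k bound_in_Cons)
  have lhs: "holds v (SEx # s) \<rho> \<longleftrightarrow> (\<exists>a. enc a = r \<and> wf_qbsf a \<and> bound_in \<rho> (fv a - {(i, n)}) \<and>
      (\<exists>l \<in> tables m. eval (env_int ((k, l) # \<rho>)) a) = v)"
  proof -
    have "holds v (SEx # s) \<rho> \<longleftrightarrow> (\<exists>a. enc a = r \<and> wf_qbsf (Ex i n a) \<and> bound_in \<rho> (fv (Ex i n a))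
        \<and> eval (env_int \<rho>) (Ex i n a) = v)"
      unfolding holds_def enc by blast
    also have "\<dots> \<longleftrightarrow> (\<exists>a. enc a = r \<and> wf_qbsf a \<and> bound_in \<rho> (fv a - {(i, n)}) \<and>
        (\<exists>F. eval ((env_int \<rho>)(i := (env_int \<rho> i)(n := F))) a) = v)"
      by (simp only: wf_qbsf.simps fv.simps eval.simps)
    also have "\<dots> \<longleftrightarrow> (\<exists>a. enc a = r \<and> wf_qbsf a \<and> bound_in \<rho> (fv a - {(i, n)}) \<and>
        (\<exists>l \<in> tables m. eval (env_int ((k, l) # \<rho>)) a) = v)"
      using ex by (intro ex_cong1 conj_cong refl) simp
    finally show ?thesis .
  qed
  have unique: "a = a'" if "enc a = r" "enc a' = r" "wf_qbsf a" "wf_qbsf a'" for a a'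
    using enc_prefix_free[of a a' "[]" "[]"] that by simp
  have empty: "[] \<in> tables m" by (simp add: tables_def)
  show ?thesis
  proof (cases v)
    case True
    then show ?thesis unfolding lhs using Some kr by (auto simp: quant_def holds_def bound)
  next
    case False
    \<comment> \<open>For a false claim the table is chosen before the formula. Pulling the formula
      out uses unique readability, and \<open>[] \<in> tables m\<close> keeps the right-hand side
      from holding vacuously.\<close>
    have "(\<exists>a. enc a = r \<and> wf_qbsf a \<and> bound_in \<rho> (fv a - {(i, n)}) \<and>
        (\<forall>l \<in> tables m. \<not> eval (env_int ((k, l) # \<rho>)) a))
      \<longleftrightarrow> (\<forall>l \<in> tables m. \<exists>a. enc a = r \<and> wf_qbsf a \<and> bound_in \<rho> (fv a - {(i, n)}) \<and>
        \<not> eval (env_int ((k, l) # \<rho>)) a)" (is "?L \<longleftrightarrow> ?R")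
    proof
      assume R: ?R
      then obtain a where "enc a = r" "wf_qbsf a" "bound_in \<rho> (fv a - {(i, n)})" using empty by blast
      moreover then have "\<forall>l \<in> tables m. \<not> eval (env_int ((k, l) # \<rho>)) a" using R unique by metis
      ultimately show ?L by blast
    qed blast
    then show ?thesis unfolding lhs using Some kr False by (simp add: quant_def holds_def bound)
  qed
qed

text \<open>For a given formula, split at its arguments and claim their true values. Conversely,
  pieces with correct claims are codes of formulas, and the head combines them into one;
  \<open>keys\<close> ensures that a head found in the environment is a genuine key.\<close>

lemma holds_head:
  assumes "a \<noteq> SEx" and keys: "\<And>k. k \<in> fst ` set \<rho> \<Longrightarrow> \<exists>i n. k = key i n"
  shows "holds v (a # s) \<rho> \<longleftrightarrow> (\<exists>hs ps. s = hs @ concat (map snd ps) \<and> (\<forall>(u, p) \<in> set ps. p \<noteq> []) \<and>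
     (\<forall>(u, p) \<in> set ps. holds u p \<rho>) \<and> head_ok v (a # hs) (map fst ps) \<rho>)" (is "_ \<longleftrightarrow> ?R")
proof
  assume "holds v (a # s) \<rho>"
  then obtain \<phi> where \<phi>: "enc \<phi> = a # s" "wf_qbsf \<phi>" "bound_in \<rho> (fv \<phi>)" "eval (env_int \<rho>) \<phi> = v"
    by (auto simp: holds_def)
  show ?R
  proof (cases \<phi>)
    case FF
    with \<phi> show ?thesis by (intro exI[of _ "[]"]) auto
  next
    case TT
    with \<phi> show ?thesis by (intro exI[of _ "[]"]) auto
  next
    case (App i n as)
    let ?ps = "map (\<lambda>b. (eval (env_int \<rho>) b, enc b)) as"
    have "map snd ?ps = map enc as" "map fst ?ps = map (eval (env_int \<rho>)) as" by simp_all
    moreover have "a = SApp" "s = key i n @ concat (map enc as)"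
      using \<phi>(1) unfolding App enc_App by auto
    moreover have "look (key i n) (map (eval (env_int \<rho>)) as) v \<rho>"
      using \<phi> by (subst look_iff) (auto simp: App env_int_def bound_in_simps)
    moreover have "\<forall>(u, p) \<in> set ?ps. p \<noteq> [] \<and> holds u p \<rho>"
      using \<phi> by (auto simp: App holds_def enc_nonempty bound_in_simps)
    ultimately show ?thesis
      using \<phi> by (intro exI[of _ "key i n"] exI[of _ ?ps]) (auto simp: App arity_ok_key o_def)
  next
    case (Conj b c)
    let ?ps = "map (\<lambda>b. (eval (env_int \<rho>) b, enc b)) [b, c]"
    show ?thesis
      by (rule exI[of _ "[]"], rule exI[of _ ?ps])
        (use \<phi> Conj in \<open>auto simp: holds_def enc_nonempty bound_in_simps\<close>)
  next
    case (Neg b)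
    let ?ps = "[(eval (env_int \<rho>) b, enc b)]"
    show ?thesis
      by (rule exI[of _ "[]"], rule exI[of _ ?ps])
        (use \<phi> Neg in \<open>auto simp: holds_def enc_nonempty bound_in_simps\<close>)
  next
    case (Ex i n b)
    with \<phi> assms show ?thesis by auto
  qed
next
  assume ?R
  then obtain hs ps where s: "s = hs @ concat (map snd ps)" and ps: "\<forall>(u, p) \<in> set ps. holds u p \<rho>"
    and head: "head_ok v (a # hs) (map fst ps) \<rho>" by blast
  have "\<exists>as. map enc as = map snd ps \<and> map (eval (env_int \<rho>)) as = map fst ps \<and>
      (\<forall>b \<in> set as. wf_qbsf b \<and> bound_in \<rho> (fv b))"
    using ps
  proof (induction ps)
    case (Cons up ps)
    then obtain as where "map enc as = map snd ps" "map (eval (env_int \<rho>)) as = map fst ps"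
      "\<forall>b \<in> set as. wf_qbsf b \<and> bound_in \<rho> (fv b)" by auto
    moreover obtain b where "enc b = snd up" "wf_qbsf b" "bound_in \<rho> (fv b)" "eval (env_int \<rho>) b = fst up"
      using Cons.prems by (cases up) (auto simp: holds_def)
    ultimately show ?case by (intro exI[of _ "b # as"]) auto
  qed simp
  then obtain as where as: "map enc as = map snd ps" "map (eval (env_int \<rho>)) as = map fst ps"
    "\<forall>b \<in> set as. wf_qbsf b \<and> bound_in \<rho> (fv b)" by blast
  have s': "s = hs @ concat (map enc as)" and len: "length ps = length as"
    using s as(1) by (simp_all, metis length_map)
  show "holds v (a # s) \<rho>"
  proof (cases a)
    case SZero
    then show ?thesis using head s' as by (auto simp: holds_def bound_in_simps intro!: exI[of _ FF])
  next
    case SOne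
    then show ?thesis using head s' as by (auto simp: holds_def bound_in_simps intro!: exI[of _ TT])
  next
    case SNeg
    then have h: "hs = []" "map fst ps = [\<not> v]" using head by auto
    then obtain b where b: "as = [b]" "eval (env_int \<rho>) b = (\<not> v)" using as(2) by auto
    then show ?thesis using SNeg h s' as(3) unfolding holds_def by (intro exI[of _ "Neg b"]) auto
  next
    case SAnd
    then obtain u u' where h: "hs = []" "map fst ps = [u, u']" "v = (u \<and> u')" using head by auto
    then obtain b c where b: "as = [b, c]" "eval (env_int \<rho>) b = u" "eval (env_int \<rho>) c = u'"
      using as(2) by auto
    then show ?thesis using SAnd h s' as(3) unfolding holds_def
      by (intro exI[of _ "Conj b c"]) (auto simp: bound_in_simps)
  next
    case SApp
    then have h: "arity_ok hs (length as)" "look hs (map (eval (env_int \<rho>)) as) v \<rho>" using head as(2) len by auto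
    then have l: "hs \<in> fst ` set \<rho>" "look hs (map (eval (env_int \<rho>)) as) True \<rho> = v"
      using look_iff by blast+
    then obtain i n where k: "hs = key i n" using keys by blast
    then have "length as = n" using h arity_ok_key by simp
    then show ?thesis using SApp s' k l as(3) unfolding holds_def
      by (intro exI[of _ "App i n as"]) (auto simp: bound_in_simps env_int_def key_def)
  next
    case SEx
    then show ?thesis using assms by simp
  qed (use head in auto)
qed

section \<open>Correctness and complexity\<close>

lemma length_pieces:
  assumes "\<forall>(u, p) \<in> set ps. p \<noteq> []"
  shows "length ps \<le> length (concat (map snd ps))"
    and "length (concat (map piece ps)) = length ps + length (concat (map snd ps))"
proof -
  show "length ps \<le> length (concat (map snd ps))"
    using assms
  proof (induction ps)
    case (Cons up ps)
    obtain u p where "up = (u, p)" by (cases up)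
    then show ?case using Cons by (cases p) auto
  qed simp
  show "length (concat (map piece ps)) = length ps + length (concat (map snd ps))"
    by (induction ps) (auto simp: piece_def)
qed

lemma length_enc_env_Cons: "length (enc_env ((k, l) # \<rho>)) = length k + length l + 2 + length (enc_env \<rho>)"
  by (simp add: enc_env_def)

text \<open>\<open>N\<close> bounds the input and \<open>m\<close> is the length of the yardstick.
  \<open>D\<close> bounds both the fixed cost of a round and the growth of the environment at a
  quantifier; the first inequality serves the other nodes, the second one quantifiers.\<close>

locale eval_bounds =
  fixes N m D :: nat
  assumes m: "2 ^ N \<le> m"
    and D: "N + (N + 1) * (2 * N + 4) + 7 * N + 20 \<le> D" "2 * m + 2 * N + 6 \<le> D"
begin

text \<open>With \<open>n\<close> symbols left the environment can grow to \<open>e + n * D\<close>;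
  each of at most \<open>n + 1\<close> rounds is charged \<open>D\<close> and twice that length, the
  latter for a lookup.\<close>

definition time :: "nat \<Rightarrow> nat \<Rightarrow> nat" where
  "time n e = (n + 1) * (D + 2 * (e + n * D))"

text \<open>Two switches per section for the final lookup and a constant number per remaining
  symbol, which also covers the section that a quantifier adds.\<close>

definition alts :: "nat \<Rightarrow> nat \<Rightarrow> nat" where
  "alts n r = 2 * r + 8 * (n + 1)"

lemma time_mono: "n \<le> n' \<Longrightarrow> e \<le> e' \<Longrightarrow> time n e \<le> time n' e'"
  unfolding time_def by (intro mult_le_mono add_le_mono) auto

lemma time_Suc: "time n (e + D) + D \<le> time (Suc n) e"
  by (simp add: time_def algebra_simps)

lemma time_Suc_head: "time n e + D + 2 * e \<le> time (Suc n) e"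
  by (simp add: time_def algebra_simps)

text \<open>Every round hands on a strictly shorter string. The environment is generalized since
  quantifiers extend it, \<open>x\<close> and \<open>b\<close> since earlier rounds leave material
  there.\<close>

lemma run_eval:
  assumes "length s \<le> N" "ok_env \<rho>" "\<And>k. k \<in> fst ` set \<rho> \<Longrightarrow> \<exists>i n. k = key i n"
  shows "run (time (length s) (length (enc_env \<rho>))) (alts (length s) (length \<rho>)) (Eval v) (map P s)
    (enc_env \<rho>) x b (replicate m BEnd) [] (holds v s \<rho>)"
  using assms
proof (induction "length s" arbitrary: s \<rho> v x b rule: less_induct)
  case less
  let ?E = "enc_env \<rho>" and ?Y = "replicate m BEnd"
  let ?e = "length ?E"
  show ?case
  proof (cases s)
    case Nil
    have "run 1 (alts 0 (length \<rho>)) Move [] ?E (HMark v # x) (HMark v # b) ?Y [] False"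
      by (rule run_reject) auto
    moreover have "2 \<le> time 0 ?e" using D(2) by (simp add: time_def)
    ultimately have "run (time 0 ?e) (alts 0 (length \<rho>)) (Eval v) [] ?E x b ?Y [] False"
      by - (rule run_step[where a = "(Move, Keep, Keep, Push (HMark v), Push (HMark v), Keep, Keep)"
          and t = 1 and g = "alts 0 (length \<rho>)"], auto)
    moreover have "\<not> holds v s \<rho>" using enc_nonempty by (auto simp: holds_def Nil)
    ultimately show ?thesis by (simp add: Nil)
  next
    case (Cons a s')
    let ?n = "length s'"
    show ?thesis
    proof (cases "a = SEx")
      case True
      have m': "2 ^ ?n \<le> m"
      proof -
        have "(2 :: nat) ^ ?n \<le> 2 ^ N" using less.prems(1) Cons by (intro power_increasing) auto
        then show ?thesis by (rule order_trans[OF _ m])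
      qed
      note holds = holds_Ex[OF m', of v \<rho>]
      have eval: "run (time (length s) ?e) (alts (length s) (length \<rho>)) (Eval v) (map P s) ?E x b ?Y [] w"
        if "run (time (length s) ?e - 1) (alts (length s) (length \<rho>)) (Hdr False False v) (map P s') ?E (HMark v # x) b ?Y [] w" for w
      proof -
        have "Suc (time (length s) ?e - 1) \<le> time (length s) ?e" using D(2) by (simp add: time_def)
        then show ?thesis using that
          by - (rule run_step[where a = "(Hdr False False v, Pop, Keep, Push (HMark v), Keep, Keep, Keep)"
              and t = "time (length s) ?e - 1" and g = "alts (length s) (length \<rho>)"], auto simp: Cons True)
      qed
      show ?thesis
      proof (cases "header False False s'")
        case None
        have "?n + 1 \<le> time (length s) ?e - 1"
          using time_Suc[of ?n ?e] D(2) less.prems(1) Cons by simp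
        then have "run (time (length s) ?e - 1) (alts (length s) (length \<rho>)) (Hdr False False v) (map P s') ?E (HMark v # x) b ?Y [] False"
          by (rule decides_mono[OF run_header_None[OF None] _ order_refl])
        from eval[OF this] show ?thesis using holds None by (simp add: Cons True)
      next
        case (Some kr)
        obtain k r where kr: "kr = (k, r)" by (cases kr)
        then obtain i n where k: "k = key i n" and s': "s' = key i n @ r" using Some header_SomeE by metis
        have len: "length r < length s" "length r < ?n" "length k \<le> N" "?n < N"
          using less.prems(1) by (auto simp: Cons s' k key_def)
        let ?T = "time ?n (?e + D)" and ?g = "alts ?n (length \<rho> + 1)"
        let ?f = "\<lambda>l. holds v r ((k, l) # \<rho>)"
        have rewind: "run (?T + length k + 1 + m + 1) ?g (Rewind v) (map P r) (l @ SecEnd # ?E)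
            (rev (map P k) @ HMark v # x) b (replicate (m - length l) BEnd) (replicate (length l) BEnd @ []) (?f l)"
          if l: "l \<in> tables m" for l
        proof -
          have l': "length l \<le> m" "SecEnd \<notin> set l" using l by (auto simp: tables_def)
          have "run (time (length r) (length (enc_env ((k, l) # \<rho>)))) (alts (length r) (length ((k, l) # \<rho>))) (Eval v)
            (map P r) (enc_env ((k, l) # \<rho>)) (HMark v # x) b ?Y [] (?f l)"
          proof (rule less.hyps[OF len(1)])
            show "length r \<le> N" using len by simp
            show "ok_env ((k, l) # \<rho>)" using less.prems(2) l' by (simp add: ok_env_def)
            show "\<And>k'. k' \<in> fst ` set ((k, l) # \<rho>) \<Longrightarrow> \<exists>i n. k' = key i n" using less.prems(3) k by auto
          qed
          then have "run ?T ?g (Eval v) (map P r) (map P k @ HEnd # l @ SecEnd # ?E) (HMark v # x) b ?Y [] (?f l)"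
          proof -
            assume *: "run (time (length r) (length (enc_env ((k, l) # \<rho>)))) (alts (length r) (length ((k, l) # \<rho>))) (Eval v)
              (map P r) (enc_env ((k, l) # \<rho>)) (HMark v # x) b ?Y [] (?f l)"
            have "enc_env ((k, l) # \<rho>) = map P k @ HEnd # l @ SecEnd # ?E" by (simp add: enc_env_def)
            \<comment> \<open>The new section has at most \<open>N + m + 2\<close> symbols, hence at
              most \<open>D\<close>.\<close>
            moreover have "time (length r) (length (enc_env ((k, l) # \<rho>))) \<le> ?T"
              using len l' D(2) by (intro time_mono) (simp_all add: length_enc_env_Cons)
            moreover have "alts (length r) (length ((k, l) # \<rho>)) \<le> ?g"
              using len by (simp add: alts_def)
            ultimately show ?thesis using decides_mono[OF *] by simp
          qed
          then have "run (?T + length k + 1) ?g (PutHdr v) (map P r) (HEnd # l @ SecEnd # ?E)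
              (rev (map P k) @ HMark v # x) b ?Y [] (?f l)"
            by (rule run_put_header)
          then have "run (?T + length k + 1 + length l + 1) ?g (Rewind v) (map P r) (l @ SecEnd # ?E)
              (rev (map P k) @ HMark v # x) b (replicate (m - length l) BEnd) (replicate (length l) BEnd) (?f l)"
            by (intro run_rewind) (use l' in simp)
          then show ?thesis using l' by simp (elim decides_mono, auto)
        qed
        have "run (?T + length k + 1 + m + 1 + m + 1) (?g + 1) (Table v) (map P r) (SecEnd # ?E)
            (rev (map P k) @ HMark v # x) b ?Y [] (quant (st_kind (Table v)) (tables m) ?f)"
          by (rule run_table) (use rewind in simp)
        then have "run (?T + length k + 1 + m + 1 + m + 1 + ?n + 1) (?g + 1 + 1) (Hdr False False v) (map P s') ?E
            (HMark v # x) b ?Y [] (quant (st_kind (Table v)) (tables m) ?f)"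
          by (rule run_header_Some[OF Some[unfolded kr]])
        moreover have "?T + length k + 1 + m + 1 + m + 1 + ?n + 1 \<le> time (length s) ?e - 1"
          using time_Suc[of ?n ?e] D(2) len by (simp add: Cons)
        moreover have "?g + 1 + 1 \<le> alts (length s) (length \<rho>)" by (simp add: alts_def Cons)
        ultimately have "run (time (length s) ?e - 1) (alts (length s) (length \<rho>)) (Hdr False False v) (map P s') ?E
            (HMark v # x) b ?Y [] (quant (st_kind (Table v)) (tables m) ?f)"
          by (rule decides_mono)
        from eval[OF this] show ?thesis using holds Some kr by (simp add: Cons True)
      qed
    next
      case False
      let ?C = "N + (N + 1) * (2 * N + 4) + 8"
      \<comment> \<open>A sum instead of a maximum: a challenged argument takes
        \<open>time ?n ?e\<close>, the check of the head \<open>2 * ?e + ?C\<close>, and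
        \<open>?T\<close> must cover either.\<close>
      let ?T = "time ?n ?e + 2 * ?e + ?C" and ?g = "alts ?n (length \<rho>)"
      let ?val = "\<lambda>hs ps. (\<forall>(u, p) \<in> set ps. holds u p \<rho>) \<and> head_ok v (a # hs) (map fst ps) \<rho>"
      let ?X = "P a # HMark v # x" and ?B = "HMark v # b"
      have pick: "run (?T + 5 * N + 3) (?g + 1) Pick [] ?E (rev l @ ?X) ?B ?Y [] (?val hs ps)"
        if l: "l = map P hs @ concat (map piece ps)" and s': "s' = hs @ concat (map snd ps)"
          and ne: "\<forall>(u, p) \<in> set ps. p \<noteq> []" for l hs ps
      proof -
        have piece_len: "length p \<le> ?n" if "(u, p) \<in> set ps" for u p
        proof -
          have "length p \<le> length (concat (map snd ps))" using that by (induction ps) auto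
          then show ?thesis by (simp add: s')
        qed
        have n: "?n < N" using less.prems(1) by (simp add: Cons)
        have R: "run (?T + 2 * length (concat (map piece ps)) + length (a # hs) + 2) (?g + 1) Pick [] ?E
          (rev (HMark v # map P (a # hs) @ concat (map piece ps)) @ x) ?B ?Y []
          ((\<forall>(u, p) \<in> set ps. holds u p \<rho>) \<and> head_ok v (a # hs) (map fst ps) \<rho>)"
        proof (rule run_pick)
          fix u p x b assume up: "(u, p) \<in> set ps"
          have "run (time (length p) ?e) (alts (length p) (length \<rho>)) (Eval u) (map P p) ?E x b ?Y [] (holds u p \<rho>)"
            by (rule less.hyps) (use piece_len[OF up] n less.prems in \<open>auto simp: Cons\<close>)
          then show "run ?T ?g (Eval u) (map P p) ?E x b ?Y [] (holds u p \<rho>)"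
            by (rule decides_mono)
              (use piece_len[OF up] time_mono[OF piece_len[OF up], of ?e ?e] in \<open>auto simp: alts_def\<close>)
        next
          have "run (2 * ?e + N + (N + 1) * (2 * N + 4) + 8) (2 * length \<rho> + 2) (Check v) (map P (a # hs)) ?E x
              (map Mark (map fst ps) @ ?B) ?Y [] (head_ok v (a # hs) (map fst ps) \<rho>)"
            by (rule run_check[OF less.prems(2)]) (use length_pieces(1)[OF ne] n in \<open>auto simp: s'\<close>)
          then show "run ?T (?g + 1) (Check v) (map P (a # hs)) ?E x (map Mark (map fst ps) @ ?B) ?Y []
              (head_ok v (a # hs) (map fst ps) \<rho>)"
            by (rule decides_mono) (auto simp: alts_def)
        qed
        have X: "rev (HMark v # map P (a # hs) @ concat (map piece ps)) @ x = rev l @ ?X"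
          by (simp add: l)
        have le: "?T + 2 * length (concat (map piece ps)) + length (a # hs) + 2 \<le> ?T + 5 * N + 3"
          using length_pieces[OF ne] n by (simp add: s')
        show ?thesis using decides_mono[OF R le order_refl] unfolding X .
      qed
      \<comment> \<open>Choosing the outcome by \<open>SOME\<close> makes it a function of the
        guessed string; by \<open>decides_unique\<close> it equals \<open>?val hs ps\<close> for
        each way of reading the string as head and pieces.\<close>
      define f where "f = (\<lambda>l. SOME w. run (?T + 5 * N + 3) (?g + 1) Pick [] ?E (rev l @ ?X) ?B ?Y [] w)"
      have f: "f l = ?val hs ps" if "l = map P hs @ concat (map piece ps)" "s' = hs @ concat (map snd ps)"
        "\<forall>(u, p) \<in> set ps. p \<noteq> []" for l hs ps
      proof -
        have "run (?T + 5 * N + 3) (?g + 1) Pick [] ?E (rev l @ ?X) ?B ?Y [] (f l)"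
          unfolding f_def by (rule someI) (rule pick[OF that])
        then show ?thesis using pick[OF that] by (rule decides_unique)
      qed
      have "run (?T + 5 * N + 3 + 2 * ?n + 1) (?g + 1 + 1) Guess (map P s') ?E ?X ?B ?Y [] (\<exists>l \<in> annots s'. f l)"
      proof (rule run_guess)
        fix l assume "l \<in> annots s'"
        then obtain hs ps where *: "l = map P hs @ concat (map piece ps)" "s' = hs @ concat (map snd ps)"
          "\<forall>(u, p) \<in> set ps. p \<noteq> []" unfolding annots_pieces by blast
        show "run (?T + 5 * N + 3) (?g + 1) Pick [] ?E (rev l @ ?X) ?B ?Y [] (f l)"
          unfolding f[OF *] by (rule pick[OF *])
      qed
      then have "run (?T + 5 * N + 3 + 2 * ?n + 2) (?g + 1 + 1) Move (map P s) ?E (HMark v # x) ?B ?Y [] (\<exists>l \<in> annots s'. f l)"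
        by - (rule run_step[where a = "(Guess, Pop, Keep, Push (P a), Keep, Keep, Keep)"
            and t = "?T + 5 * N + 3 + 2 * ?n + 1" and g = "?g + 1 + 1"], auto simp: Cons)
      then have "run (?T + 5 * N + 3 + 2 * ?n + 3) (?g + 1 + 1) (Eval v) (map P s) ?E x b ?Y [] (\<exists>l \<in> annots s'. f l)"
        using False by - (rule run_step[where a = "(Move, Keep, Keep, Push (HMark v), Push (HMark v), Keep, Keep)"
            and t = "?T + 5 * N + 3 + 2 * ?n + 2" and g = "?g + 1 + 1"], auto simp: Cons)
      moreover have "?T + 5 * N + 3 + 2 * ?n + 3 \<le> time (length s) ?e"
        using time_Suc_head[of ?n ?e] D(1) less.prems(1) by (simp add: Cons)
      moreover have "?g + 1 + 1 \<le> alts (length s) (length \<rho>)" by (simp add: alts_def Cons)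
      ultimately have "run (time (length s) ?e) (alts (length s) (length \<rho>)) (Eval v) (map P s) ?E x b ?Y [] (\<exists>l \<in> annots s'. f l)"
        by (rule decides_mono)
      moreover have "(\<exists>l \<in> annots s'. f l) = holds v s \<rho>"
      proof -
        have "(\<exists>l \<in> annots s'. f l) \<longleftrightarrow> (\<exists>hs ps. s' = hs @ concat (map snd ps) \<and> (\<forall>(u, p) \<in> set ps. p \<noteq> []) \<and> ?val hs ps)"
        proof
          assume "\<exists>l \<in> annots s'. f l"
          then obtain l where "l \<in> annots s'" "f l" ..
          then obtain hs ps where *: "l = map P hs @ concat (map piece ps)" "s' = hs @ concat (map snd ps)"
            "\<forall>(u, p) \<in> set ps. p \<noteq> []" unfolding annots_pieces by (elim exE conjE)
          from \<open>f l\<close> have "?val hs ps" unfolding f[OF *] .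
          with *(2,3) show "\<exists>hs ps. s' = hs @ concat (map snd ps) \<and> (\<forall>(u, p) \<in> set ps. p \<noteq> []) \<and> ?val hs ps"
            by (intro exI[of _ hs] exI[of _ ps] conjI) simp_all
        next
          assume "\<exists>hs ps. s' = hs @ concat (map snd ps) \<and> (\<forall>(u, p) \<in> set ps. p \<noteq> []) \<and> ?val hs ps"
          then obtain hs ps where *: "s' = hs @ concat (map snd ps)" "\<forall>(u, p) \<in> set ps. p \<noteq> []" "?val hs ps"
            by (elim exE conjE) (rule that, assumption+, rule conjI)
          let ?l = "map P hs @ concat (map piece ps)"
          have "f ?l" unfolding f[OF refl *(1,2)] by (rule *(3))
          moreover have "?l \<in> annots s'" unfolding annots_pieces using *(1,2) by (intro exI[of _ hs] exI[of _ ps] conjI) simp_all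
          ultimately show "\<exists>l \<in> annots s'. f l" ..
        qed
        also have "\<dots> \<longleftrightarrow> holds v s \<rho>"
          unfolding Cons by (rule holds_head[OF False less.prems(3), symmetric])
        finally show ?thesis .
      qed
      ultimately show ?thesis by simp
    qed
  qed
qed

end

section \<open>Bounds for the whole input\<close>

lemma holds_QBSF: "holds True w [] \<longleftrightarrow> w \<in> QBSF"
proof -
  have "bound_in [] A \<longleftrightarrow> A = {}" for A by (auto simp: bound_in_def)
  moreover have "env_int [] = empty_interp" by (simp add: env_int_def empty_interp_def fun_eq_iff)
  ultimately show ?thesis by (auto simp: holds_def QBSF_def QBSF_formulas_def)
qed

text \<open>A value of \<open>D\<close> that satisfies both inequalities of
  \<open>eval_bounds\<close> for \<open>N = n\<close> and \<open>m = 2 ^ n\<close>.\<close>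

definition level_cost :: "nat \<Rightarrow> nat" where
  "level_cost n = (n + 1) * (2 * n + 4) + 8 * n + 2 * 2 ^ n + 20"

text \<open>This is \<open>time n 0\<close> with \<open>D = level_cost n\<close>, written outside
  the locale as one function of \<open>n\<close>.\<close>

definition eval_time :: "nat \<Rightarrow> nat" where
  "eval_time n = (n + 1) * (level_cost n + 2 * (n * level_cost n))"

text \<open>The summands after \<open>eval_time\<close> bound the cost of
  \<open>run_boot_loop\<close> with \<open>m = 1\<close> and the step out of
  \<open>Boot\<close>.\<close>

definition total_time :: "nat \<Rightarrow> nat" where
  "total_time n = eval_time n + 4 * 2 ^ n + 4 * n + 3"

lemma run_input:
  assumes "run (eval_time (length w)) h (Eval True) (map P w) [] [] [] (replicate (2 ^ length w) BEnd) [] v"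
  shows "decides qm.kd_conf qm.next_confs (total_time (length w)) h (Boot, qm.input w) v"
proof -
  have "run (eval_time (length w) + 4 * 2 ^ length w + 4 * length w + 2) h BLoop (map P w) [] [] [] (replicate 1 BEnd) [] v"
    by (rule run_boot_loop[where t = "eval_time (length w)"]) (use assms in simp_all)
  then have "run (total_time (length w)) h Boot (map P w) [] [] [] [] [] v"
    by - (rule run_step[where a = "(BLoop, Keep, Keep, Keep, Keep, Push BEnd, Keep)"
        and t = "eval_time (length w) + 4 * 2 ^ length w + 4 * length w + 2" and g = h], auto simp: total_time_def)
  moreover have "qm.input w = stacks (map P w) [] [] [] [] []"
    by (auto simp: qm.input_def stacks_def fun_eq_iff split: stk.splits)
  ultimately show ?thesis by simp
qed

text \<open>The general bound at length 0 is \<open>alts 0 0 = 8\<close>; here the switch budget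
  \<open>h\<close> is arbitrary and may be 0.\<close>

lemma run_eval_Nil:
  assumes "2 \<le> t"
  shows "run t h (Eval v) [] e x b y z False"
proof -
  have "run 1 h Move [] e (HMark v # x) (HMark v # b) y z False"
    by (rule run_reject) auto
  then show ?thesis using assms
    by - (rule run_step[where a = "(Move, Keep, Keep, Push (HMark v), Push (HMark v), Keep, Keep)"
        and t = 1 and g = h], auto)
qed

definition alternations :: "nat \<Rightarrow> nat" where
  "alternations n = (if n = 0 then 0 else 8 * (n + 1))"

lemma machine_decides_QBSF:
  "decides qm.kd_conf qm.next_confs (total_time (length w)) (alternations (length w)) (Boot, qm.input w) (w \<in> QBSF)"
proof (rule run_input, cases "w = []")
  case True
  have "\<not> holds True [] []" using enc_nonempty by (auto simp: holds_def)
  then have "w \<notin> QBSF" by (simp add: True flip: holds_QBSF)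
  moreover have "2 \<le> eval_time 0" by (simp add: eval_time_def level_cost_def)
  ultimately show "run (eval_time (length w)) (alternations (length w)) (Eval True) (map P w) [] [] []
      (replicate (2 ^ length w) BEnd) [] (w \<in> QBSF)"
    using run_eval_Nil[of "eval_time 0"] by (simp add: True)
next
  case False
  interpret eval_bounds "length w" "2 ^ length w" "level_cost (length w)"
    by unfold_locales (simp_all add: level_cost_def)
  have "run (time (length w) (length (enc_env []))) (alts (length w) (length ([] :: env))) (Eval True) (map P w)
    (enc_env []) [] [] (replicate (2 ^ length w) BEnd) [] (holds True w [])"
    by (rule run_eval) (simp_all add: ok_env_def)
  then show "run (eval_time (length w)) (alternations (length w)) (Eval True) (map P w) [] [] []
      (replicate (2 ^ length w) BEnd) [] (w \<in> QBSF)"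
    using False by (simp add: holds_QBSF time_def eval_time_def alts_def alternations_def enc_env_def)
qed

text \<open>With \<open>X = 2 ^ n\<close> and \<open>n + 1\<close> \<le> \<open>X\<close> every
  factor is bounded by a monomial in \<open>X\<close>. The coefficients are 36 = 6 + 8 + 2 + 20 for
  a level, 108 = 36 + 72 for the evaluation, 119 = 108 + 4 + 4 + 3 in total and 243 = 2 * 120 + 3
  for the overhead; 119 * 243 is below \<open>2 ^ 18\<close>.\<close>

lemma total_time_bound: "total_time n * (2 * (n + total_time n) + 3) \<le> 2 ^ 18 * 2 ^ (8 * n)"
proof -
  define X :: nat where "X = 2 ^ n"
  have n: "n + 1 \<le> X" unfolding X_def by (induction n) auto
  then have X: "1 \<le> X" "n \<le> X" by auto
  have X2: "X \<le> X ^ 2" "1 \<le> X ^ 2" using X self_le_power[of X 2] by auto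
  have X4: "X \<le> X ^ 4" "1 \<le> X ^ 4" using X self_le_power[of X 4] by auto
  define A where "A = (n + 1) * (2 * n + 4)"
  have "A \<le> X * (6 * X)" unfolding A_def using n X by (intro mult_le_mono) auto
  then have "A \<le> 6 * X ^ 2" by (simp add: power2_eq_square)
  moreover have "level_cost n = A + 8 * n + 2 * X + 20" by (simp add: level_cost_def A_def X_def)
  ultimately have L: "level_cost n \<le> 36 * X ^ 2" using X X2 by linarith
  have "(n + 1) * (level_cost n + 2 * (n * level_cost n)) \<le> X * (36 * X ^ 2 + 2 * (X * (36 * X ^ 2)))"
    using n X L by (intro mult_le_mono add_le_mono) auto
  also have "\<dots> = 36 * X ^ 3 + 72 * X ^ 4" by (simp add: power_def algebra_simps numeral_eq_Suc)
  also have "\<dots> \<le> 108 * X ^ 4" using power_increasing[of 3 4 X] X by simp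
  finally have "eval_time n \<le> 108 * X ^ 4" by (simp only: eval_time_def)
  moreover have "total_time n = eval_time n + 4 * X + 4 * n + 3" by (simp add: total_time_def X_def)
  ultimately have T: "total_time n \<le> 119 * X ^ 4" using X X4 by linarith
  have "n \<le> X ^ 4" using X(2) X4(1) by (rule order_trans)
  then have "2 * (n + total_time n) + 3 \<le> 2 * (X ^ 4 + 119 * X ^ 4) + 3 * X ^ 4"
    using T X4(2) by (intro add_le_mono mult_le_mono2) simp_all
  then have "2 * (n + total_time n) + 3 \<le> 243 * X ^ 4" by simp
  then have "total_time n * (2 * (n + total_time n) + 3) \<le> (119 * X ^ 4) * (243 * X ^ 4)"
    using T by (intro mult_le_mono)
  also have "\<dots> = 28917 * X ^ 8" by (simp flip: power_add)
  also have "\<dots> \<le> 2 ^ 18 * X ^ 8" by simp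
  also have "X ^ 8 = 2 ^ (8 * n)" by (simp add: X_def mult.commute flip: power_mult)
  finally show ?thesis .
qed

lemma poly_bounded_time: "poly_bounded (\<lambda>n. 8 * n)"
  unfolding poly_bounded_def
proof (intro exI allI)
  fix n :: nat
  show "8 * n \<le> (n + 1) ^ 4"
  proof (cases "n = 0")
    case False
    then have "(2 :: nat) ^ 3 \<le> (n + 1) ^ 3" by (intro power_mono) auto
    then have "2 ^ 3 * n \<le> (n + 1) ^ 3 * (n + 1)" by (intro mult_le_mono) auto
    also have "\<dots> = (n + 1) ^ 4" by (simp add: power_def numeral_eq_Suc mult.commute)
    finally show ?thesis by simp
  qed simp
qed

text \<open>At length 0 a polynomially bounded function is at most 1: the empty word is decided without
  any alternation.\<close>

lemma poly_bounded_alternations: "poly_bounded (\<lambda>n. Suc (alternations n))"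
  unfolding poly_bounded_def
proof (intro exI allI)
  fix n :: nat
  show "Suc (alternations n) \<le> (n + 1) ^ 5"
  proof (cases "n = 0")
    case False
    then have "(2 :: nat) ^ 4 \<le> (n + 1) ^ 4" by (intro power_mono) auto
    then have "2 ^ 4 * (n + 1) \<le> (n + 1) ^ 4 * (n + 1)" by (intro mult_le_mono1)
    also have "\<dots> = (n + 1) ^ 5" by (simp add: power_def numeral_eq_Suc mult.commute)
    finally show ?thesis using False by (simp add: alternations_def)
  qed (simp add: alternations_def)
qed

theorem theorem4:
  shows "QBSF \<in> AEXP_poly"
proof -
  have "QBSF \<in> ATIME_Sigma (\<lambda>n. 2 ^ (8 * n)) (\<lambda>n. Suc (alternations n))"
    by (rule qm.stack_machine_ATIME[OF machine_decides_QBSF total_time_bound]) simp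
  moreover have "\<forall>n. 1 \<le> Suc (alternations n)" by simp
  ultimately show ?thesis
    unfolding AEXP_poly_def using poly_bounded_time poly_bounded_alternations by blast
qed

end
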